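(* The cubic theta graphs $T_{1,1,m}$ and $T_{1,2,m}$ $(m\ge 1)$, $T_{2,2,2}$, $T_{2,2,3}$, $T_{2,2,4}$, $T_{2,3,3}$, $T_{2,3,4}$ and $T_{3,3,3}$ are not edge-reflexive. All other cubic theta graphs $T_{k,l,m}$ $(k,l,m\ge 1)$ are edge-reflexive.
   Context: Half-edges are edges incident with only one vertex. The cubic theta graph $T_{k,l,m}$ ($k,l,m\ge 1$) is constructed as follows. Take three paths of lengths $k$, $l$, $m$ (numbers of edges) with vertices $u_0,\dots,u_k$, $v_0,\dots,v_l$ and $w_0,\dots,w_m$, respectively. Identify the vertices $u_0,v_0,w_0$, and identify the vertices $u_k,v_l,w_m$ (parallel edges that arise are kept). Finally, add half-edges to make the graph cubic, that is, one half-edge at every vertex of degree two. Up to isomorphism, $T_{k,l,m}$ does not depend on the order of the parameters, so the triples may be taken with $k\le l\le m$; "all other cubic theta graphs" means those whose parameters are not, up to permutation, among the triples listed. The line graph $L(G)$ of such a graph $G$ is the graph whose vertices are all edges of $G$ (full edges and half-edges), two distinct ones being adjacent if they are incident with a common vertex. A 3-coloring of a graph $X$ is an unordered partition $\{V_1,V_2,V_3\}$ of $V(X)$ into three independent sets (a part may be empty); the $V_i$ are the color classes of the coloring. For a 3-colorable graph $X$, the 3-coloring complex $B(X)$ is the graph whose vertices are all color classes of all 3-colorings of $X$, with two vertices $C\neq D$ joined by an edge if $C$ and $D$ appear together in a 3-coloring of $X$. If $X$ is a 3-colorable graph without isolated vertices, then $B(X)$ is 3-colorable and the canonical map $\phi_X(v)=\{C\in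 V(B(X)) : v\in C\}$, $v\in V(X)$, is a graph homomorphism $X\to B(B(X))$. The graph $X$ is reflexive if $\phi_X$ is an isomorphism. The graph $G$ is 3-edge-colorable if $L(G)$ is 3-colorable, and edge-reflexive if it is 3-edge-colorable and $L(G)$ is reflexive.
   Formalization: T_{1,1,1} is edge-reflexive (its line graph is a triangle, and the canonical map is an isomorphism), so T_{1,1,m} is claimed not edge-reflexive only for m ≥ 2, and T_{1,1,1} is counted among the edge-reflexive cubic theta graphs. *)

theory Defs
  imports Main "HOL-Library.Multiset"
begin

section \<open>Simple graphs and 3-colorings\<close>

record 'a sgraph =
  verts :: "'a set"
  edges :: "'a set set"

definition adjacent :: "'a sgraph \<Rightarrow> 'a \<Rightarrow> 'a \<Rightarrow> bool" where
  "adjacent X u v \<longleftrightarrow> {u, v} \<in> edges X"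

definition independent_set :: "'a sgraph \<Rightarrow> 'a set \<Rightarrow> bool" where
  "independent_set X S \<longleftrightarrow> S \<subseteq> verts X \<and> (\<forall>u\<in>S. \<forall>v\<in>S. \<not> adjacent X u v)"

definition no_isolated :: "'a sgraph \<Rightarrow> bool" where
  "no_isolated X \<longleftrightarrow> (\<forall>u\<in>verts X. \<exists>v\<in>verts X. adjacent X u v)"

definition graph_isomorphism :: "('a \<Rightarrow> 'b) \<Rightarrow> 'a sgraph \<Rightarrow> 'b sgraph \<Rightarrow> bool" where
  "graph_isomorphism f X Y \<longleftrightarrow>
     bij_betw f (verts X) (verts Y) \<and>
     (\<forall>u\<in>verts X. \<forall>v\<in>verts X. adjacent X u v \<longleftrightarrow> adjacent Y (f u) (f v))"

text \<open>
  A 3-coloring is the set \<open>{V1, V2, V3}\<close> of its color classes. Parts may be empty; two empty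
  parts coincide in this set, which loses no information because nonempty parts are distinct.
\<close>

definition three_coloring :: "'a sgraph \<Rightarrow> 'a set set \<Rightarrow> bool" where
  "three_coloring X P \<longleftrightarrow>
     (\<exists>V1 V2 V3. P = {V1, V2, V3} \<and>
        V1 \<union> V2 \<union> V3 = verts X \<and>
        V1 \<inter> V2 = {} \<and> V1 \<inter> V3 = {} \<and> V2 \<inter> V3 = {} \<and>
        independent_set X V1 \<and> independent_set X V2 \<and> independent_set X V3)"

definition three_colorable :: "'a sgraph \<Rightarrow> bool" where
  "three_colorable X \<longleftrightarrow> (\<exists>P. three_coloring X P)"

definition coloring_complex :: "'a sgraph \<Rightarrow> 'a set sgraph" where
  "coloring_complex X =
     \<lparr> verts = {C. \<exists>P. three_coloring X P \<and> C \<in> P},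
       edges = {{C, D} | C D. C \<noteq> D \<and> (\<exists>P. three_coloring X P \<and> C \<in> P \<and> D \<in> P)} \<rparr>"

definition canonical_map :: "'a sgraph \<Rightarrow> 'a \<Rightarrow> 'a set set" where
  "canonical_map X v = {C \<in> verts (coloring_complex X). v \<in> C}"

definition reflexive_graph :: "'a sgraph \<Rightarrow> bool" where
  "reflexive_graph X \<longleftrightarrow>
     three_colorable X \<and> no_isolated X \<and>
     graph_isomorphism (canonical_map X) X (coloring_complex (coloring_complex X))"


section \<open>Multigraphs with half-edges\<close>

text \<open>
  \<open>ends e\<close> is the set of vertices incident with \<open>e\<close>: two vertices for a full edge,
  one vertex for a half-edge. Parallel edges are distinct edges with the same ends.
\<close>

record ('v, 'e) multigraph =
  mverts :: "'v set"
  medges :: "'e set"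
  ends :: "'e \<Rightarrow> 'v set"

definition line_graph :: "('v, 'e) multigraph \<Rightarrow> 'e sgraph" where
  "line_graph G =
     \<lparr> verts = medges G,
       edges = {{e, f} | e f. e \<in> medges G \<and> f \<in> medges G \<and> e \<noteq> f \<and>
                              (\<exists>x\<in>mverts G. x \<in> ends G e \<and> x \<in> ends G f)} \<rparr>"

definition three_edge_colorable :: "('v, 'e) multigraph \<Rightarrow> bool" where
  "three_edge_colorable G \<longleftrightarrow> three_colorable (line_graph G)"

definition edge_reflexive :: "('v, 'e) multigraph \<Rightarrow> bool" where
  "edge_reflexive G \<longleftrightarrow> three_edge_colorable G \<and> reflexive_graph (line_graph G)"


section \<open>Cubic theta graphs\<close>

datatype theta_path = PathU | PathV | PathW

text \<open>
  \<open>Source\<close> is the vertex obtained by identifying the initial vertices of the three paths,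
  \<open>Sink\<close> the one obtained from their final vertices, and \<open>Inner p i\<close> is the \<open>i\<close>-th vertex
  of path \<open>p\<close> otherwise. \<open>Step p i\<close> is the edge of path \<open>p\<close> from its \<open>i\<close>-th to its
  \<open>(i+1)\<close>-st vertex.
\<close>

datatype theta_vertex = Source | Sink | Inner theta_path nat

datatype theta_edge = Step theta_path nat | Half theta_vertex

fun path_length :: "nat \<Rightarrow> nat \<Rightarrow> nat \<Rightarrow> theta_path \<Rightarrow> nat" where
  "path_length k l m PathU = k"
| "path_length k l m PathV = l"
| "path_length k l m PathW = m"

definition path_vertex :: "nat \<Rightarrow> nat \<Rightarrow> nat \<Rightarrow> theta_path \<Rightarrow> nat \<Rightarrow> theta_vertex" where
  "path_vertex k l m p i =
     (if i = 0 then Source else if i = path_length k l m p then Sink else Inner p i)"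

fun theta_ends :: "nat \<Rightarrow> nat \<Rightarrow> nat \<Rightarrow> theta_edge \<Rightarrow> theta_vertex set" where
  "theta_ends k l m (Step p i) = {path_vertex k l m p i, path_vertex k l m p (Suc i)}"
| "theta_ends k l m (Half x) = {x}"

definition theta_verts :: "nat \<Rightarrow> nat \<Rightarrow> nat \<Rightarrow> theta_vertex set" where
  "theta_verts k l m = {path_vertex k l m p i | p i. i \<le> path_length k l m p}"

definition theta_steps :: "nat \<Rightarrow> nat \<Rightarrow> nat \<Rightarrow> theta_edge set" where
  "theta_steps k l m = {Step p i | p i. i < path_length k l m p}"

definition theta_halves :: "nat \<Rightarrow> nat \<Rightarrow> nat \<Rightarrow> theta_edge set" where
  "theta_halves k l m =
     {Half x | x. x \<in> theta_verts k l m \<and>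
                  card {e \<in> theta_steps k l m. x \<in> theta_ends k l m e} = 2}"

definition cubic_theta :: "nat \<Rightarrow> nat \<Rightarrow> nat \<Rightarrow> (theta_vertex, theta_edge) multigraph" where
  "cubic_theta k l m =
     \<lparr> mverts = theta_verts k l m,
       medges = theta_steps k l m \<union> theta_halves k l m,
       ends = theta_ends k l m \<rparr>"

text \<open>
  The listed parameter triples up to permutation, as multisets. The family \<open>(1, 1, m)\<close> starts at
  \<open>m = 2\<close>, although the source has \<open>m \<ge> 1\<close> there: the line graph of the theta graph with
  parameters \<open>(1, 1, 1)\<close> is a triangle, which has a single 3-coloring, with three singleton
  classes. Its coloring complex is a triangle again and the canonical map sends \<open>v\<close> to
  \<open>{{v}}\<close>, which is an isomorphism; so this theta graph is edge-reflexive.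
\<close>

definition listed_parameters :: "nat multiset set" where
  "listed_parameters =
     {{#1, 1, m#} | m. m \<ge> 2} \<union> {{#1, 2, m#} | m. m \<ge> 1} \<union>
     {{#2, 2, 2#}, {#2, 2, 3#}, {#2, 2, 4#}, {#2, 3, 3#}, {#2, 3, 4#}, {#3, 3, 3#}}"

end

(*
  A colouring of the line graph assigns distinct colours to the three edges of every star, so every
  star gives a 3-coloring of the complex: a class is coloured by the edge of the star it contains.
  The graph is edge-reflexive as soon as any two edges are separated by some colouring and every
  3-coloring of the complex comes from a star.

  Under mild conditions on the lengths, both properties persist when a path of length n >= 3 is
  replaced by one of length n + 1. The colourings of the long graph in which the steps i and i + 2 of
  the path have different colours are those of the short graph, pulled back along a map of edges that
  sends stars to stars; hence on them a 3-coloring of the complex is given by a star. Using this for two consecutive places and comparing the two stars, all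
  colourings are covered except those that start with abab, and two of the three classes of such a
  colouring also occur in colourings already treated.

  This leaves eleven small graphs, for which all 3-colorings of the complex are found by search. The
  same search produces, in the sporadic exceptions, a 3-coloring that is not given by a star. In the
  families (1, 1, m) and (1, 2, m) two edges have the same colour in every colouring.
*)
theory Submission
  imports Defs
begin

section \<open>Edge colourings of cubic theta graphs\<close>

text \<open>The obstacle is that the two places yield their stars independently. On the colourings
  covered by both, which start with abca, the stars need only agree up to edges of equal colour, so
  one has to know exactly which edges these are. That is settled by mapping the long path onto one
  shorter by three, with b and c borrowed from the other two paths, and it is the reason why each
  step of the induction needs separation at a length three below the new one. With a path of length
  one this fails until the new length is at least six, which explains the largest of the small
  graphs.

  The remaining ambiguity lies in the first four steps and their half-edges. It is removed by the
  choice among stars with the same image, by half-edges whose colour is forced, by one colouring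
  starting with abab, or by a second path of length at least two.\<close>

datatype colour = Red | Green | Blue

lemma UNIV_colour: "UNIV = {Red, Green, Blue}"
  using colour.exhaust by auto

instance colour :: finite
  by standard (simp add: UNIV_colour)

lemma card_colour [simp]: "card (UNIV :: colour set) = 3"
  by (simp add: UNIV_colour)

lemma all_colour: "(\<forall>a. P a) \<longleftrightarrow> P Red \<and> P Green \<and> P Blue"
  using colour.exhaust by metis

lemma UNIV_theta_path: "UNIV = {PathU, PathV, PathW}"
  using theta_path.exhaust by auto

lemma all_theta_path: "(\<forall>p. P p) \<longleftrightarrow> P PathU \<and> P PathV \<and> P PathW"
  using theta_path.exhaust by metis

lemma inj_endo_surj:
  fixes f :: "colour \<Rightarrow> colour"
  assumes "inj f" shows "surj f"
  using finite_UNIV_inj_surj[OF finite assms] .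

lemma colour_perm_eq:
  fixes f g :: "colour \<Rightarrow> colour"
  assumes "inj f" "inj g" "a \<noteq> b" "f a = g a" "f b = g b"
  shows "f = g"
proof
  fix x
  show "f x = g x"
  proof (cases "x = a \<or> x = b")
    case True then show ?thesis using assms by auto
  next
    case False
    have "f x \<noteq> f a" "f x \<noteq> f b" "f a \<noteq> f b" using False assms(1,3) by (simp_all add: inj_eq)
    moreover have "g x \<noteq> f a" "g x \<noteq> f b" using False assms(2) by (simp_all add: inj_eq assms(4,5))
    ultimately
    show ?thesis by (metis colour.exhaust)
  qed
qed

text \<open>As a function of the path, a length change is \<open>L(p := n)\<close> and a permutation
  of the paths is \<open>L \<circ> \<pi>\<close>, so no argument has to be repeated for each of the
  three paths.\<close>

type_synonym lengths = "theta_path \<Rightarrow> nat"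

definition edges_of :: "lengths \<Rightarrow> theta_edge set" where
  "edges_of L = {Step p i | p i. i < L p} \<union> {Half (Inner p i) | p i. 0 < i \<and> i < L p}"

definition vertices_of :: "lengths \<Rightarrow> theta_vertex set" where
  "vertices_of L = {Source, Sink} \<union> {Inner p i | p i. 0 < i \<and> i < L p}"

text \<open>A path of length one contributes its only step to both branch stars. The subtraction at
  the sink is meant for positive lengths.\<close>

fun star :: "lengths \<Rightarrow> theta_vertex \<Rightarrow> theta_edge set" where
  "star L Source = range (\<lambda>p. Step p 0)"
| "star L Sink = range (\<lambda>p. Step p (L p - 1))"
| "star L (Inner p i) = {Step p (i - 1), Step p i, Half (Inner p i)}"

definition positive :: "lengths \<Rightarrow> bool" where
  "positive L \<longleftrightarrow> (\<forall>p. 0 < L p)"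

text \<open>Colours are assigned to all of \<open>theta_edge\<close>, and values outside
  \<open>edges_of L\<close> are arbitrary; colourings are therefore compared on
  \<open>edges_of L\<close> only.\<close>

definition edge_colouring :: "lengths \<Rightarrow> (theta_edge \<Rightarrow> colour) \<Rightarrow> bool" where
  "edge_colouring L c \<longleftrightarrow> (\<forall>x\<in>vertices_of L. inj_on c (star L x))"

definition colour_class :: "lengths \<Rightarrow> (theta_edge \<Rightarrow> colour) \<Rightarrow> colour \<Rightarrow> theta_edge set" where
  "colour_class L c a = {e \<in> edges_of L. c e = a}"

lemma star_subset: "positive L \<Longrightarrow> x \<in> vertices_of L \<Longrightarrow> star L x \<subseteq> edges_of L"
  unfolding positive_def vertices_of_def edges_of_def by auto

lemma card_star: "x \<in> vertices_of L \<Longrightarrow> card (star L x) = 3"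
  unfolding vertices_of_def by (auto simp: card_insert_if UNIV_theta_path)

lemma finite_star [simp]: "finite (star L x)"
  by (cases x) (auto simp: UNIV_theta_path)

lemma edge_in_star:
  assumes "e \<in> edges_of L"
  shows "\<exists>x\<in>vertices_of L. e \<in> star L x"
proof -
  consider p i where "e = Step p i" "i < L p" | p i where "e = Half (Inner p i)" "0 < i" "i < L p"
    using assms unfolding edges_of_def by auto
  then show ?thesis
  proof cases
    case 1
    show ?thesis
    proof (cases "i = 0")
      case True then show ?thesis using 1 by (auto simp: vertices_of_def)
    next
      case False then show ?thesis using 1 
        by (intro bexI[of _ "Inner p i"]) (auto simp: vertices_of_def)
    qed
  next
    case 2 then show ?thesis
      by (intro bexI[of _ "Inner p i"]) (auto simp: vertices_of_def)
  qed
qed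

section \<open>The line graph of a cubic theta graph described by stars\<close>

context
  fixes k l m :: nat and L
  assumes pos: "k \<ge> 1" "l \<ge> 1" "m \<ge> 1"
  defines "L \<equiv> path_length k l m"
begin

lemma positive_L: "positive L"
  unfolding positive_def L_def by (simp add: all_theta_path) (use pos in simp)

lemma L_pos: "0 < L p"
  using positive_L unfolding positive_def by auto

lemma theta_verts_eq: "theta_verts k l m = vertices_of L"
proof
  show "theta_verts k l m \<subseteq> vertices_of L"
    by (auto simp: theta_verts_def vertices_of_def path_vertex_def L_def)
  show "vertices_of L \<subseteq> theta_verts k l m"
  proof
    fix x assume "x \<in> vertices_of L"
    then consider "x = Source" | "x = Sink" | p i where "x = Inner p i" "0 < i" "i < L p"
      by (auto simp: vertices_of_def)
    then show "x \<in> theta_verts k l m"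
    proof cases
      case 1 then show ?thesis unfolding theta_verts_def path_vertex_def by force
    next
      case 2 
      have "x = path_vertex k l m PathU k"
        using 2 pos by (simp add: path_vertex_def)
      moreover have "k \<le> path_length k l m PathU" by simp
      ultimately show ?thesis unfolding theta_verts_def by blast
    next
      case 3
      have "x = path_vertex k l m p i" "i \<le> path_length k l m p"
        using 3 by (auto simp: path_vertex_def L_def)
      then show ?thesis unfolding theta_verts_def by blast
    qed
  qed
qed

lemma step_incident:
  assumes "x \<in> vertices_of L" "i < L p"
  shows "x \<in> theta_ends k l m (Step p i) \<longleftrightarrow> Step p i \<in> star L x"
  using assms L_pos[of p]
  by (cases x) (auto simp: path_vertex_def vertices_of_def L_def[symmetric])

text \<open>A branch vertex meets three steps, one of each path, and an inner vertex meets two; so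
  exactly the inner vertices receive half-edges.\<close>

lemma theta_halves_eq: "theta_halves k l m = {Half (Inner p i) | p i. 0 < i \<and> i < L p}"
proof -
  have "card {e \<in> theta_steps k l m. x \<in> theta_ends k l m e} = 2 \<longleftrightarrow> (\<exists>p i. x = Inner p i)"
    if x: "x \<in> vertices_of L" for x
  proof -
    have eq: "{e \<in> theta_steps k l m. x \<in> theta_ends k l m e} = star L x \<inter> range (\<lambda>(p, i). Step p i)"
    proof -
      have "e \<in> theta_steps k l m \<and> x \<in> theta_ends k l m e \<longleftrightarrow> e \<in> star L x \<inter> range (\<lambda>(p, i). Step p i)" for e
      proof (cases e)
        case (Step p i)
        have "Step p i \<in> star L x \<Longrightarrow> i < L p"
          using star_subset[OF positive_L x] by (auto simp: edges_of_def)
        then show ?thesis using step_incident[OF x, of i p] Step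
          by (auto simp: theta_steps_def L_def[symmetric])
      qed (auto simp: theta_steps_def)
      then show ?thesis by blast
    qed
    show ?thesis
    proof (cases x)
      case Source
      have "star L x \<inter> range (\<lambda>(p, i). Step p i) = star L x" using Source by auto
      then show ?thesis using eq card_star[OF x] Source by simp
    next
      case Sink
      have "star L x \<inter> range (\<lambda>(p, i). Step p i) = star L x" using Sink by auto
      then show ?thesis using eq card_star[OF x] Sink by simp
    next
      case (Inner p i)
      have "0 < i" using x Inner by (auto simp: vertices_of_def)
      have "star L x \<inter> range (\<lambda>(p, i). Step p i) = {Step p (i - 1), Step p i}" using Inner by auto
      then show ?thesis using eq Inner \<open>0 < i\<close> by (simp add: card_insert_if)
    qed
  qed
  then have "theta_halves k l m = {Half x | x. x \<in> vertices_of L \<and> (\<exists>p i. x = Inner p i)}"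
    unfolding theta_halves_def theta_verts_eq by blast
  then show ?thesis by (auto simp: vertices_of_def)
qed

lemma medges_eq: "medges (cubic_theta k l m) = edges_of L"
  by (simp add: cubic_theta_def theta_halves_eq edges_of_def theta_steps_def L_def)

lemma incident:
  assumes "x \<in> vertices_of L" "e \<in> edges_of L"
  shows "x \<in> theta_ends k l m e \<longleftrightarrow> e \<in> star L x"
proof (cases e)
  case (Step p i)
  then show ?thesis using assms step_incident by (auto simp: edges_of_def)
next
  case (Half y)
  then show ?thesis using assms by (cases x) (auto simp: edges_of_def)
qed

lemma adjacent_line_graph:
  assumes "e \<in> edges_of L" "e' \<in> edges_of L"
  shows "adjacent (line_graph (cubic_theta k l m)) e e' \<longleftrightarrow>
    e \<noteq> e' \<and> (\<exists>x\<in>vertices_of L. e \<in> star L x \<and> e' \<in> star L x)"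
proof -
  have "adjacent (line_graph (cubic_theta k l m)) e e' \<longleftrightarrow>
     e \<noteq> e' \<and> (\<exists>x\<in>mverts (cubic_theta k l m). x \<in> ends (cubic_theta k l m) e \<and> x \<in> ends (cubic_theta k l m) e')"
    using assms unfolding adjacent_def line_graph_def medges_eq
    by (auto simp: doubleton_eq_iff)
  also have "\<dots> \<longleftrightarrow> e \<noteq> e' \<and> (\<exists>x\<in>vertices_of L. e \<in> star L x \<and> e' \<in> star L x)"
    using incident assms by (auto simp: cubic_theta_def theta_verts_eq)
  finally show ?thesis .
qed

lemma verts_line_graph: "verts (line_graph (cubic_theta k l m)) = edges_of L"
  by (simp add: line_graph_def medges_eq)

end

text \<open>An unordered partition is turned into the fibres of a map to \<open>colour\<close>,
  empty parts being empty fibres. The graph is arbitrary because this is applied to the line graph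
  and again to its complex.\<close>

lemma three_coloring_iff:
  "three_coloring X P \<longleftrightarrow> (\<exists>h :: 'a \<Rightarrow> colour.
     (\<forall>u\<in>verts X. \<forall>v\<in>verts X. adjacent X u v \<longrightarrow> h u \<noteq> h v) \<and> P = range (\<lambda>a. {v\<in>verts X. h v = a}))"
  (is "_ \<longleftrightarrow> (\<exists>h. ?Q h)")
proof
  assume "three_coloring X P"
  then obtain V1 V2 V3 where V: "P = {V1, V2, V3}" "V1 \<union> V2 \<union> V3 = verts X"
      "V1 \<inter> V2 = {}" "V1 \<inter> V3 = {}" "V2 \<inter> V3 = {}"
      "independent_set X V1" "independent_set X V2" "independent_set X V3"
    unfolding three_coloring_def by auto
  define h where "h v = (if v \<in> V1 then Red else if v \<in> V2 then Green else Blue)" for v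
  have "{v\<in>verts X. h v = Red} = V1" "{v\<in>verts X. h v = Green} = V2" "{v\<in>verts X. h v = Blue} = V3"
    using V unfolding h_def by auto
  then have "P = range (\<lambda>a. {v\<in>verts X. h v = a})"
    using V(1) by (simp add: UNIV_colour)
  moreover have "h u \<noteq> h v" if uv: "u \<in> verts X" "v \<in> verts X" "adjacent X u v" for u v
  proof
    assume "h u = h v"
    then have "u \<in> V1 \<and> v \<in> V1 \<or> u \<in> V2 \<and> v \<in> V2 \<or> u \<in> V3 \<and> v \<in> V3"
      using uv(1,2) V(2) unfolding h_def by (auto split: if_splits)
    then show False using uv(3) V(6-8) unfolding independent_set_def by blast
  qed
  ultimately show "\<exists>h. ?Q h" by blast
next
  assume "\<exists>h. ?Q h"
  then obtain h :: "'a \<Rightarrow> colour" where h: "?Q h" by blast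
  let ?V = "\<lambda>a. {v\<in>verts X. h v = a}"
  have "P = {?V Red, ?V Green, ?V Blue}" using h by (auto simp: UNIV_colour)
  moreover have "?V Red \<union> ?V Green \<union> ?V Blue = verts X"
    using colour.exhaust by auto
  moreover have "independent_set X (?V a)" for a
  proof -
    have "\<not> adjacent X u v" if "u \<in> ?V a" "v \<in> ?V a" for u v
      using conjunct1[OF h] that by force
    then show ?thesis unfolding independent_set_def by blast
  qed
  moreover have "?V Red \<inter> ?V Green = {}" "?V Red \<inter> ?V Blue = {}" "?V Green \<inter> ?V Blue = {}"
    by auto
  ultimately show "three_coloring X P"
    unfolding three_coloring_def
    by (intro exI[of _ "?V Red"] exI[of _ "?V Green"] exI[of _ "?V Blue"] conjI)
qed

section \<open>Colourings of the complex and reflexivity\<close>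

text \<open>The classes of one edge colouring are nonempty and distinct, hence form a triangle of
  the complex, and every edge of the complex lies in such a triangle. Being a proper colouring thus
  means being injective on each of these triples.\<close>

definition complex_colouring :: "lengths \<Rightarrow> (theta_edge set \<Rightarrow> colour) \<Rightarrow> bool" where
  "complex_colouring L f \<longleftrightarrow> (\<forall>c. edge_colouring L c \<longrightarrow> inj (\<lambda>a. f (colour_class L c a)))"

definition star_enum :: "lengths \<Rightarrow> (colour \<Rightarrow> theta_edge) \<Rightarrow> bool" where
  "star_enum L s \<longleftrightarrow> (\<exists>x\<in>vertices_of L. bij_betw s UNIV (star L x))"

definition dictates ::
  "lengths \<Rightarrow> (theta_edge set \<Rightarrow> colour) \<Rightarrow> (colour \<Rightarrow> theta_edge) \<Rightarrow> (theta_edge \<Rightarrow> colour) \<Rightarrow> bool" where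
  "dictates L f s c \<longleftrightarrow> (\<forall>a. f (colour_class L c (c (s a))) = a)"

text \<open>
  In \<open>dictates L f s c\<close>, the edge \<open>s a\<close> is the one whose class receives the colour \<open>a\<close> under \<open>f\<close>.
\<close>

definition dictatorial :: "lengths \<Rightarrow> bool" where
  "dictatorial L \<longleftrightarrow> (\<forall>f. complex_colouring L f \<longrightarrow>
     (\<exists>s. star_enum L s \<and> (\<forall>c. edge_colouring L c \<longrightarrow> dictates L f s c)))"

definition separated :: "lengths \<Rightarrow> bool" where
  "separated L \<longleftrightarrow> (\<forall>e\<in>edges_of L. \<forall>e'\<in>edges_of L. e \<noteq> e' \<longrightarrow>
     (\<exists>c. edge_colouring L c \<and> c e \<noteq> c e'))"

definition colour_classes :: "lengths \<Rightarrow> theta_edge set set" where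
  "colour_classes L = {colour_class L c a | c a. edge_colouring L c}"

lemma star_enum_range: "positive L \<Longrightarrow> star_enum L s \<Longrightarrow> s a \<in> edges_of L"
  using star_subset unfolding star_enum_def bij_betw_def by blast

lemma star_enum_inj:
  assumes "star_enum L s" "edge_colouring L c"
  shows "inj (\<lambda>a. c (s a))"
proof -
  obtain x where "x \<in> vertices_of L" "bij_betw s UNIV (star L x)"
    using assms unfolding star_enum_def by auto
  then have "inj_on c (range s)" "inj s"
    using assms unfolding edge_colouring_def bij_betw_def by auto
  then show ?thesis unfolding inj_def inj_on_def by blast
qed

lemma star_enum_through:
  assumes "x \<in> vertices_of L"
  shows "\<exists>s. star_enum L s \<and> range s = star L x"
proof -
  have "card (UNIV :: colour set) = card (star L x)" using card_star[OF assms] by simp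
  then obtain s where "bij_betw s (UNIV :: colour set) (star L x)"
    using finite_same_card_bij[OF finite finite_star] by metis
  then show ?thesis using assms unfolding star_enum_def bij_betw_def by auto
qed

text \<open>All three colours occur at the source, so no class is empty, and different classes are
  disjoint.\<close>

lemma colour_class_inj:
  assumes "edge_colouring L c" "positive L"
  shows "inj (colour_class L c)"
proof -
  have "Source \<in> vertices_of L" by (simp add: vertices_of_def)
  then obtain s where s: "star_enum L s" using star_enum_through by blast
  have "\<exists>e\<in>edges_of L. c e = a" for a
    using inj_endo_surj[OF star_enum_inj[OF s assms(1)]] star_enum_range[OF assms(2) s]
    unfolding surj_def by metis
  then show ?thesis by (intro injI) (auto simp: colour_class_def set_eq_iff, metis)
qed

lemma edge_colouring_iff_star:
  "edge_colouring L c \<longleftrightarrow> (\<forall>e\<in>edges_of L. \<forall>e'\<in>edges_of L. 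
     e \<noteq> e' \<and> (\<exists>x\<in>vertices_of L. e \<in> star L x \<and> e' \<in> star L x) \<longrightarrow> c e \<noteq> c e')" if "positive L"
  using star_subset[OF that] unfolding edge_colouring_def inj_on_def by blast

lemma colour_class_eq_iff:
  assumes "edge_colouring L c" "positive L" "e \<in> edges_of L" "inj (\<lambda>a. f (colour_class L c a))"
    and "f (colour_class L c (c e)) = b"
  shows "f (colour_class L c a) = b \<longleftrightarrow> e \<in> colour_class L c a"
proof -
  have "f (colour_class L c a) = b \<longleftrightarrow> a = c e"
    using inj_eq[OF assms(4), of a "c e"] assms(5) by simp
  moreover have "e \<in> colour_class L c a \<longleftrightarrow> a = c e"
    using assms(3) by (auto simp: colour_class_def)
  ultimately show ?thesis by blast
qed

text \<open>The colouring of the complex given by a star: every class contains exactly one edge of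
  the star. On sets that are not classes the choice is arbitrary.\<close>

definition edge_function :: "(colour \<Rightarrow> theta_edge) \<Rightarrow> theta_edge set \<Rightarrow> colour" where
  "edge_function s C = (SOME a. s a \<in> C)"

lemma edge_function:
  assumes "positive L" "star_enum L s" "edge_colouring L c"
  shows "edge_function s (colour_class L c (c (s a))) = a"
  unfolding edge_function_def colour_class_def
  using star_enum_range[OF assms(1,2)] star_enum_inj[OF assms(2,3)]
  by (intro some_equality) (auto dest: injD)

lemma dictated_complex_colouring:
  assumes "\<And>c. edge_colouring L c \<Longrightarrow> dictates L f s c" "star_enum L s"
  shows "complex_colouring L f"
  unfolding complex_colouring_def
proof (intro allI impI)
  fix c assume c: "edge_colouring L c"
  show "inj (\<lambda>a. f (colour_class L c a))"
  proof (rule injI)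
    fix a b assume ab: "f (colour_class L c a) = f (colour_class L c b)"
    obtain a' b' where "a = c (s a')" "b = c (s b')" 
      using inj_endo_surj[OF star_enum_inj[OF assms(2) c]] unfolding surj_def by metis
    with ab show "a = b" using assms(1)[OF c] unfolding dictates_def by simp
  qed
qed

section \<open>Vertices and edges of the complex of the complex\<close>

context
  fixes k l m :: nat and L X B
  assumes pos: "k \<ge> 1" "l \<ge> 1" "m \<ge> 1"
  defines "L \<equiv> path_length k l m"
  defines "X \<equiv> line_graph (cubic_theta k l m)"
  defines "B \<equiv> coloring_complex X"
begin

lemmas posL = positive_L[OF pos, folded L_def]
lemmas vertsX = verts_line_graph[OF pos, folded L_def X_def]
lemmas adjX = adjacent_line_graph[OF pos, folded L_def X_def]

lemma three_coloring_X: "three_coloring X P \<longleftrightarrow> (\<exists>c. edge_colouring L c \<and> P = range (colour_class L c))"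
proof -
  have "(\<forall>u\<in>edges_of L. \<forall>v\<in>edges_of L. adjacent X u v \<longrightarrow> h u \<noteq> h v) \<longleftrightarrow> edge_colouring L h" for h
    using edge_colouring_iff_star[OF posL] adjX by simp
  then show ?thesis unfolding three_coloring_iff vertsX colour_class_def[abs_def] by auto
qed

lemma verts_B: "verts B = colour_classes L"
  unfolding B_def coloring_complex_def colour_classes_def three_coloring_X by auto

lemma adjacent_B: "adjacent B C D \<longleftrightarrow> C \<noteq> D \<and> (\<exists>c a b. edge_colouring L c \<and> C = colour_class L c a \<and> D = colour_class L c b)"
proof -
  have "adjacent B C D \<longleftrightarrow> C \<noteq> D \<and> (\<exists>P. three_coloring X P \<and> C \<in> P \<and> D \<in> P)"
    unfolding adjacent_def B_def coloring_complex_def by (auto simp: doubleton_eq_iff)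
  then show ?thesis unfolding three_coloring_X by auto
qed

definition fibre :: "(theta_edge set \<Rightarrow> colour) \<Rightarrow> colour \<Rightarrow> theta_edge set set" where
  "fibre f a = {C \<in> colour_classes L. f C = a}"

lemma three_coloring_B: "three_coloring B P \<longleftrightarrow> (\<exists>f. complex_colouring L f \<and> P = range (fibre f))"
proof -
  have "(\<forall>C\<in>colour_classes L. \<forall>D\<in>colour_classes L. adjacent B C D \<longrightarrow> f C \<noteq> f D) \<longleftrightarrow> complex_colouring L f" (is "?l \<longleftrightarrow> ?r") for f
  proof
    assume l: ?l
    show ?r unfolding complex_colouring_def
    proof (intro allI impI injI)
      fix c a b assume c: "edge_colouring L c" and eq: "f (colour_class L c a) = f (colour_class L c b)"
      have "colour_class L c a \<in> colour_classes L" "colour_class L c b \<in> colour_classes L"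
        using c unfolding colour_classes_def by auto
      then have "\<not> adjacent B (colour_class L c a) (colour_class L c b)" using l eq by blast
      then have "colour_class L c a = colour_class L c b" unfolding adjacent_B using c by blast
      then show "a = b" using colour_class_inj[OF c posL] by (simp add: inj_eq)
    qed
  next
    assume r: ?r
    then show ?l unfolding adjacent_B complex_colouring_def by (metis injD)
  qed
  then show ?thesis unfolding three_coloring_iff verts_B fibre_def[abs_def] by auto
qed

lemma verts_BB: "verts (coloring_complex B) = {fibre f a | f a. complex_colouring L f}"
  unfolding coloring_complex_def three_coloring_B by auto

lemma adjacent_BB: "adjacent (coloring_complex B) C D \<longleftrightarrow> C \<noteq> D \<and> (\<exists>f a b. complex_colouring L f \<and> C = fibre f a \<and> D = fibre f b)"
proof -
  have "adjacent (coloring_complex B) C D \<longleftrightarrow> C \<noteq> D \<and> (\<exists>P. three_coloring B P \<and> C \<in> P \<and> D \<in> P)"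
    unfolding adjacent_def coloring_complex_def[of B] by (auto simp: doubleton_eq_iff)
  then show ?thesis unfolding three_coloring_B by auto
qed

lemma canonical_map_X: "canonical_map X e = {C \<in> colour_classes L. e \<in> C}"
  unfolding canonical_map_def B_def[symmetric] verts_B ..

text \<open>If \<open>f\<close> always gives the class of \<open>e\<close> the value
  \<open>a\<close>, then injectivity of \<open>f\<close> on the three classes keeps all classes
  avoiding \<open>e\<close> out of the fibre over \<open>a\<close>.\<close>

lemma fibre_eq_canonical_map:
  assumes "complex_colouring L f" "e \<in> edges_of L"
  shows "fibre f a = canonical_map X e \<longleftrightarrow> (\<forall>c. edge_colouring L c \<longrightarrow> f (colour_class L c (c e)) = a)"
proof
  assume eq: "fibre f a = canonical_map X e"
  show "\<forall>c. edge_colouring L c \<longrightarrow> f (colour_class L c (c e)) = a"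
  proof (intro allI impI)
    fix c assume "edge_colouring L c"
    then have "colour_class L c (c e) \<in> canonical_map X e"
      using assms(2) unfolding canonical_map_X colour_classes_def colour_class_def by auto
    then show "f (colour_class L c (c e)) = a" using eq unfolding fibre_def by auto
  qed
next
  assume r: "\<forall>c. edge_colouring L c \<longrightarrow> f (colour_class L c (c e)) = a"
  have "f (colour_class L c b) = a \<longleftrightarrow> e \<in> colour_class L c b" if "edge_colouring L c" for c b
    using that assms r posL unfolding complex_colouring_def by (intro colour_class_eq_iff) auto
  then show "fibre f a = canonical_map X e" unfolding fibre_def canonical_map_X colour_classes_def by auto
qed

lemma dictates_fibre:
  assumes "star_enum L s" "\<And>c. edge_colouring L c \<Longrightarrow> dictates L f s c"
  shows "fibre f a = canonical_map X (s a)"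
  using fibre_eq_canonical_map[OF dictated_complex_colouring[OF assms(2,1)] star_enum_range[OF posL assms(1)]]
    assms(2) unfolding dictates_def by blast

text \<open>For this half of the isomorphism no assumption on the lengths beyond positivity is made:
  the canonical map sends edges to vertices of the double complex and adjacent edges to fibres of
  one common colouring.\<close>

lemma star_fibre:
  assumes "x \<in> vertices_of L"
  shows "\<exists>f. complex_colouring L f \<and> (\<forall>e\<in>star L x. \<exists>a. fibre f a = canonical_map X e)"
proof -
  obtain s where s: "star_enum L s" "range s = star L x" using star_enum_through[OF assms] by blast
  have d: "dictates L (edge_function s) s c" if "edge_colouring L c" for c
    using edge_function[OF posL s(1) that] unfolding dictates_def by blast
  have "complex_colouring L (edge_function s)" using dictated_complex_colouring d s(1) by blast
  moreover have "\<forall>e\<in>star L x. \<exists>a. fibre (edge_function s) a = canonical_map X e"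
    using dictates_fibre[OF s(1) d] s(2) by (metis rangeE)
  ultimately show ?thesis by blast
qed

text \<open>Each colouring puts an edge into exactly one class, so two edges have the same image iff
  every colouring gives them the same colour.\<close>

lemma canonical_map_inj_iff: "inj_on (canonical_map X) (edges_of L) \<longleftrightarrow> separated L"
proof -
  have "canonical_map X e = canonical_map X e' \<longleftrightarrow> (\<forall>c. edge_colouring L c \<longrightarrow> c e = c e')"
    if "e \<in> edges_of L" "e' \<in> edges_of L" for e e'
  proof
    assume eq: "canonical_map X e = canonical_map X e'"
    show "\<forall>c. edge_colouring L c \<longrightarrow> c e = c e'"
    proof (intro allI impI)
      fix c assume "edge_colouring L c"
      then have "colour_class L c (c e) \<in> canonical_map X e"
        using that unfolding canonical_map_X colour_classes_def colour_class_def by auto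
      then show "c e = c e'" unfolding eq by (simp add: canonical_map_X colour_class_def)
    qed
  next
    assume "\<forall>c. edge_colouring L c \<longrightarrow> c e = c e'"
    then show "canonical_map X e = canonical_map X e'"
      using that unfolding canonical_map_X colour_classes_def colour_class_def by auto
  qed
  then show ?thesis unfolding inj_on_def separated_def by blast
qed

text \<open>Adjacency is reflected because adjacent vertices of the double complex are two fibres of
  one \<open>f\<close>. The star dictating \<open>f\<close> contains an edge for each of them, and
  injectivity identifies these with the given edges.\<close>

theorem edge_reflexive_if:
  assumes "edge_colouring L c0" "separated L" "dictatorial L"
  shows "edge_reflexive (cubic_theta k l m)"
proof -
  let ?\<phi> = "canonical_map X"
  have "three_colorable X" unfolding three_colorable_def three_coloring_X using assms(1) by blast
  moreover have "no_isolated X" unfolding no_isolated_def vertsX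
  proof
    fix e assume e: "e \<in> edges_of L"
    then obtain x where x: "x \<in> vertices_of L" "e \<in> star L x" using edge_in_star by blast
    then have "card (star L x - {e}) = 2" using card_star by simp
    then obtain e' where "e' \<in> star L x" "e' \<noteq> e" by (metis card.empty Diff_iff ex_in_conv singletonI zero_neq_numeral)
    then show "\<exists>e'\<in>edges_of L. adjacent X e e'" using adjX e x star_subset[OF posL] by blast
  qed
  moreover have "graph_isomorphism ?\<phi> X (coloring_complex B)"
    unfolding graph_isomorphism_def vertsX
  proof
    have inj: "inj_on ?\<phi> (edges_of L)" using assms(2) canonical_map_inj_iff by blast
    have dict: "\<exists>s. star_enum L s \<and> (\<forall>a. fibre f a = ?\<phi> (s a))" if "complex_colouring L f" for f
      using assms(3) dictates_fibre that unfolding dictatorial_def by meson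
    have "?\<phi> ` edges_of L = verts (coloring_complex B)"
    proof
      show "?\<phi> ` edges_of L \<subseteq> verts (coloring_complex B)"
        unfolding verts_BB using edge_in_star star_fibre by fastforce
      show "verts (coloring_complex B) \<subseteq> ?\<phi> ` edges_of L"
        unfolding verts_BB using dict star_enum_range[OF posL] by fastforce
    qed
    with inj show "bij_betw ?\<phi> (edges_of L) (verts (coloring_complex B))" unfolding bij_betw_def by blast
    show "\<forall>e\<in>edges_of L. \<forall>e'\<in>edges_of L. adjacent X e e' \<longleftrightarrow> adjacent (coloring_complex B) (?\<phi> e) (?\<phi> e')"
    proof (intro ballI)
      fix e e' assume e: "e \<in> edges_of L" "e' \<in> edges_of L"
      have ne: "?\<phi> e \<noteq> ?\<phi> e' \<longleftrightarrow> e \<noteq> e'" using inj e by (meson inj_on_eq_iff)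
      show "adjacent X e e' \<longleftrightarrow> adjacent (coloring_complex B) (?\<phi> e) (?\<phi> e')" (is "?l \<longleftrightarrow> ?r")
      proof
        assume ?l
        then obtain x where x: "x\<in>vertices_of L" "e \<in> star L x" "e' \<in> star L x" "e \<noteq> e'"
          using adjX e by blast
        with star_fibre[OF x(1)] show ?r unfolding adjacent_BB ne by metis
      next
        assume ?r
        then obtain f a b where f: "complex_colouring L f" "?\<phi> e = fibre f a" "?\<phi> e' = fibre f b" "e \<noteq> e'"
          unfolding adjacent_BB ne by blast
        obtain s where s: "star_enum L s" "\<And>a. fibre f a = ?\<phi> (s a)" using dict[OF f(1)] by blast
        then have "e = s a" "e' = s b" using inj f e star_enum_range[OF posL s(1)] by (auto dest: inj_onD)
        moreover obtain x where "x \<in> vertices_of L" "range s = star L x"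
          using s(1) unfolding star_enum_def bij_betw_def by blast
        ultimately show ?l using adjX e f(4) by blast
      qed
    qed
  qed
  ultimately show ?thesis
    unfolding edge_reflexive_def three_edge_colorable_def reflexive_graph_def B_def X_def by blast
qed

text \<open>The conclusion speaks of two colours because adjacency of two fibres pulls back to a
  common vertex of two edges. Three pairwise adjacent edges need not share a vertex: they can form a
  cycle of length three.\<close>

theorem edge_reflexive_imp:
  assumes "edge_reflexive (cubic_theta k l m)"
  shows "separated L"
    and "\<lbrakk>complex_colouring L f; a \<noteq> b\<rbrakk> \<Longrightarrow> \<exists>x\<in>vertices_of L. \<exists>e\<in>star L x. \<exists>e'\<in>star L x. 
       \<forall>c. edge_colouring L c \<longrightarrow> f (colour_class L c (c e)) = a \<and> f (colour_class L c (c e')) = b"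
proof -
  let ?\<phi> = "canonical_map X"
  have col: "three_colorable X" and iso: "graph_isomorphism ?\<phi> X (coloring_complex B)"
    using assms unfolding edge_reflexive_def reflexive_graph_def B_def X_def by auto
  then show "separated L" unfolding graph_isomorphism_def bij_betw_def vertsX canonical_map_inj_iff by blast
  assume f: "complex_colouring L f" and ab: "a \<noteq> b"
  obtain c0 where c0: "edge_colouring L c0" using col unfolding three_colorable_def three_coloring_X by blast
  have img: "?\<phi> ` edges_of L = verts (coloring_complex B)"
    using iso unfolding graph_isomorphism_def bij_betw_def vertsX by simp
  have ex: "\<exists>e\<in>edges_of L. fibre f d = ?\<phi> e" for d
  proof -
    have "fibre f d \<in> ?\<phi> ` edges_of L" unfolding img verts_BB using f by blast
    then show ?thesis by blast
  qed
  obtain e where e1: "e \<in> edges_of L" "fibre f a = ?\<phi> e" using ex by blast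
  obtain e' where e2: "e' \<in> edges_of L" "fibre f b = ?\<phi> e'" using ex by blast
  note e = e1 e2
  have d: "\<forall>c. edge_colouring L c \<longrightarrow> f (colour_class L c (c e)) = a" 
    "\<forall>c. edge_colouring L c \<longrightarrow> f (colour_class L c (c e')) = b"
    using fibre_eq_canonical_map[OF f e(1)] fibre_eq_canonical_map[OF f e(3)] e by blast+
  then have "e \<noteq> e'" using c0 ab by blast
  have ne: "fibre f a \<noteq> fibre f b"
  proof
    assume "fibre f a = fibre f b"
    moreover have "colour_class L c0 (c0 e) \<in> fibre f a" 
      using d(1) c0 unfolding fibre_def colour_classes_def by auto
    ultimately show False using ab unfolding fibre_def by auto
  qed
  then have "adjacent (coloring_complex B) (?\<phi> e) (?\<phi> e')" unfolding adjacent_BB e(2)[symmetric] e(4)[symmetric] using f by blast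
  then have "adjacent X e e'" using iso e unfolding graph_isomorphism_def vertsX by blast
  then obtain x where "x \<in> vertices_of L" "e \<in> star L x" "e' \<in> star L x" using adjX e by blast
  then show "\<exists>x\<in>vertices_of L. \<exists>e\<in>star L x. \<exists>e'\<in>star L x. 
       \<forall>c. edge_colouring L c \<longrightarrow> f (colour_class L c (c e)) = a \<and> f (colour_class L c (c e')) = b"
    using d by blast
qed

end

section \<open>Maps of stars\<close>

lemma third_colour:
  fixes a b d x :: colour
  assumes "a \<noteq> b" "a \<noteq> d" "b \<noteq> d" "x \<noteq> a" "x \<noteq> b" shows "x = d"
  using assms by (metis colour.exhaust)

text \<open>Edges go from \<open>L'\<close> to \<open>L\<close>, colourings from \<open>L\<close> to
  \<open>L'\<close>. Several stars may have the same image, and a step may go to a half-edge; this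
  freedom is what the maps between paths of different lengths use.\<close>

definition star_map :: "(theta_edge \<Rightarrow> theta_edge) \<Rightarrow> lengths \<Rightarrow> lengths \<Rightarrow> bool" where
  "star_map g L' L \<longleftrightarrow> (\<forall>x\<in>vertices_of L'. inj_on g (star L' x) \<and> (\<exists>y\<in>vertices_of L. g ` star L' x = star L y))"

lemma star_map_colouring:
  assumes "star_map g L' L" "edge_colouring L c"
  shows "edge_colouring L' (c \<circ> g)"
  using assms unfolding star_map_def edge_colouring_def by (metis comp_inj_on)

lemma star_map_edge:
  assumes "star_map g L' L" "positive L" "e \<in> edges_of L'"
  shows "g e \<in> edges_of L"
  using assms edge_in_star[OF assms(3)] star_subset[OF assms(2)] unfolding star_map_def by blast

lemma colour_class_comp:
  assumes "star_map g L' L" "positive L"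
  shows "colour_class L' (c \<circ> g) a = {e \<in> edges_of L'. g e \<in> colour_class L c a}"
  using star_map_edge[OF assms] unfolding colour_class_def by auto

lemma colour_class_cong:
  assumes "\<And>e. e \<in> edges_of L \<Longrightarrow> c e = c' e"
  shows "colour_class L c = colour_class L c'"
  using assms unfolding colour_class_def by auto

lemma dictates_cong:
  assumes "positive L" "star_enum L s" "\<And>e. e \<in> edges_of L \<Longrightarrow> c e = c' e" "dictates L f s c"
  shows "dictates L f s c'"
proof -
  have "colour_class L c = colour_class L c'" using assms(3) by (rule colour_class_cong)
  then show ?thesis using assms(4) unfolding dictates_def
    by (simp add: assms(3)[OF star_enum_range[OF assms(1,2)]])
qed

lemma star_enum_lift:
  assumes "bij_betw s (UNIV :: colour set) (star L y)" "inj_on g (star L' x)" "g ` star L' x = star L y"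
  shows "\<exists>s'. bij_betw s' UNIV (star L' x) \<and> (\<forall>a. g (s' a) = s a)"
proof -
  let ?h = "the_inv_into (star L' x) g"
  have "bij_betw g (star L' x) (star L y)" using assms unfolding bij_betw_def by auto
  then have h: "bij_betw ?h (star L y) (star L' x)" by (rule bij_betw_the_inv_into)
  have "g (?h (s a)) = s a" for a
    using assms by (intro f_the_inv_into_f) (auto simp: bij_betw_def)
  then show ?thesis using bij_betw_trans[OF assms(1) h] by (intro exI[of _ "?h \<circ> s"]) auto
qed

text \<open>The classes of \<open>c \<circ> g\<close> are the preimages of the classes of
  \<open>c\<close>, so evaluating \<open>f\<close> at preimages colours the complex of
  \<open>L\<close>.\<close>

lemma complex_colouring_comp:
  assumes "positive L" "star_map g L' L" "complex_colouring L' f"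
  shows "complex_colouring L (\<lambda>C. f {e \<in> edges_of L'. g e \<in> C})"
  using assms(3) star_map_colouring[OF assms(2)]
  unfolding complex_colouring_def colour_class_comp[OF assms(2,1), symmetric] by blast

text \<open>The dictating star of the induced colouring lifts to any star above it. \<open>Q\<close>
  lets the caller choose when several stars of \<open>L'\<close> lie above the same star of
  \<open>L\<close>.\<close>

lemma dictator_pullback:
  assumes "positive L" "dictatorial L" "star_map g L' L" "complex_colouring L' f"
    and lift: "\<And>y. y \<in> vertices_of L \<Longrightarrow> \<exists>x\<in>vertices_of L'. Q x \<and> g ` star L' x = star L y"
  shows "\<exists>x\<in>vertices_of L'. Q x \<and> (\<exists>s. bij_betw s UNIV (star L' x) \<and>
           (\<forall>c. edge_colouring L c \<longrightarrow> dictates L' f s (c \<circ> g)))"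
proof -
  obtain s where s: "star_enum L s"
    "\<And>c. edge_colouring L c \<Longrightarrow> dictates L (\<lambda>C. f {e \<in> edges_of L'. g e \<in> C}) s c"
    using assms(2) complex_colouring_comp[OF assms(1,3,4)] unfolding dictatorial_def by blast
  then obtain y where y: "y \<in> vertices_of L" "bij_betw s UNIV (star L y)" unfolding star_enum_def by blast
  obtain x where x: "x\<in>vertices_of L'" "Q x" "g ` star L' x = star L y" using lift[OF y(1)] by blast
  then have "inj_on g (star L' x)" using assms(3) unfolding star_map_def by blast
  with star_enum_lift[OF y(2) this x(3)] obtain s' where s': "bij_betw s' UNIV (star L' x)" "\<And>a. g (s' a) = s a"
    by blast
  have "dictates L' f s' (c \<circ> g)" if "edge_colouring L c" for c
    using s(2)[OF that] unfolding dictates_def colour_class_comp[OF assms(3,1)] by (simp add: s'(2))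
  with x s' show ?thesis by blast
qed

lemma dictatorial_iso:
  assumes "positive L" "positive L'" "dictatorial L" "star_map g L' L" "star_map h L L'"
    and "\<And>e. e \<in> edges_of L' \<Longrightarrow> h (g e) = e" "\<And>e. e \<in> edges_of L \<Longrightarrow> g (h e) = e"
  shows "dictatorial L'"
  unfolding dictatorial_def
proof (intro allI impI)
  fix f assume f: "complex_colouring L' f"
  have "\<exists>x\<in>vertices_of L'. True \<and> g ` star L' x = star L y" if y: "y \<in> vertices_of L" for y
  proof -
    obtain x where x: "x\<in>vertices_of L'" "h ` star L y = star L' x"
      using assms(5) y unfolding star_map_def by blast
    have "g ` h ` star L y = star L y"
      using assms(7) star_subset[OF assms(1) y] by (force simp: image_image)
    with x show ?thesis by metis
  qed
  from dictator_pullback[OF assms(1,3,4) f this]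
  obtain x s where x: "x\<in>vertices_of L'" "bij_betw s UNIV (star L' x)"
    "\<And>c. edge_colouring L c \<Longrightarrow> dictates L' f s (c \<circ> g)" by blast
  have s: "star_enum L' s" using x unfolding star_enum_def by blast
  have "dictates L' f s c" if c: "edge_colouring L' c" for c
    using dictates_cong[OF assms(2) s _ x(3)[OF star_map_colouring[OF assms(5) c]]] assms(6) by simp
  with s show "\<exists>s. star_enum L' s \<and> (\<forall>c. edge_colouring L' c \<longrightarrow> dictates L' f s c)" by blast
qed

lemma separated_pullback:
  assumes "positive L" "separated L" "star_map g L' L" "e \<in> edges_of L'" "e' \<in> edges_of L'" "g e \<noteq> g e'"
  shows "\<exists>c. edge_colouring L c \<and> c (g e) \<noteq> c (g e')"
  using assms star_map_edge[OF assms(3,1)] unfolding separated_def by blast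

section \<open>Permuting the three paths\<close>

fun relabel :: "(theta_path \<Rightarrow> theta_path) \<Rightarrow> theta_edge \<Rightarrow> theta_edge" where
  "relabel \<pi> (Step p i) = Step (\<pi> p) i"
| "relabel \<pi> (Half (Inner p i)) = Half (Inner (\<pi> p) i)"
| "relabel \<pi> e = e"

lemma star_map_relabel:
  assumes "bij \<pi>"
  shows "star_map (relabel \<pi>) (L \<circ> \<pi>) L"
  unfolding star_map_def
proof
  fix x assume x: "x \<in> vertices_of (L \<circ> \<pi>)"
  have eq: "\<pi> p = \<pi> q \<longleftrightarrow> p = q" for p q using assms by (simp add: bij_def inj_eq)
  have r: "range (\<lambda>p. Step (\<pi> p) (n (\<pi> p))) = range (\<lambda>p. Step p (n p))" for n
  proof -
    have "range (\<lambda>p. Step (\<pi> p) (n (\<pi> p))) = (\<lambda>p. Step p (n p)) ` range \<pi>" by auto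
    then show ?thesis using assms by (simp add: bij_def)
  qed
  show "inj_on (relabel \<pi>) (star (L \<circ> \<pi>) x) \<and> (\<exists>y\<in>vertices_of L. relabel \<pi> ` star (L \<circ> \<pi>) x = star L y)"
  proof (cases x)
    case Source then show ?thesis using r[of "\<lambda>_. 0"]
      by (auto simp: inj_on_def eq image_image vertices_of_def intro!: bexI[of _ Source])
  next
    case Sink then show ?thesis using r[of "\<lambda>p. L p - 1"]
      by (auto simp: inj_on_def eq image_image vertices_of_def intro!: bexI[of _ Sink])
  next
    case (Inner p i)
    have "Inner (\<pi> p) i \<in> vertices_of L" using x Inner by (auto simp: vertices_of_def)
    moreover have "inj_on (relabel \<pi>) (star (L \<circ> \<pi>) x)" using Inner by (auto simp: inj_on_def)
    moreover have "relabel \<pi> ` star (L \<circ> \<pi>) x = star L (Inner (\<pi> p) i)" using Inner by simp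
    ultimately show ?thesis by blast
  qed
qed

lemma relabel_inverse:
  assumes "e \<in> edges_of L" "\<And>p. \<sigma> (\<pi> p) = p"
  shows "relabel \<sigma> (relabel \<pi> e) = e"
  using assms unfolding edges_of_def by auto

context
  fixes L :: lengths and \<pi> :: "theta_path \<Rightarrow> theta_path"
  assumes pos: "positive L" and bij: "bij \<pi>"
begin

lemma positive_permute: "positive (L \<circ> \<pi>)"
  using pos unfolding positive_def by simp

lemma dictatorial_permute:
  assumes "dictatorial L"
  shows "dictatorial (L \<circ> \<pi>)"
proof (rule dictatorial_iso[OF pos positive_permute assms star_map_relabel[OF bij]])
  have "L \<circ> \<pi> \<circ> inv \<pi> = L" using bij by (simp add: fun_eq_iff bij_def surj_f_inv_f)
  then show "star_map (relabel (inv \<pi>)) L (L \<circ> \<pi>)"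
    using star_map_relabel[OF bij_imp_bij_inv[OF bij], of "L \<circ> \<pi>"] by simp
  show "relabel (inv \<pi>) (relabel \<pi> e) = e" if "e \<in> edges_of (L \<circ> \<pi>)" for e
    using relabel_inverse[OF that] bij by (simp add: bij_def)
  show "relabel \<pi> (relabel (inv \<pi>) e) = e" if "e \<in> edges_of L" for e
    using relabel_inverse[OF that] bij by (simp add: bij_def surj_f_inv_f)
qed

lemma separated_permute:
  assumes "separated L"
  shows "separated (L \<circ> \<pi>)"
  unfolding separated_def
proof (intro ballI impI)
  fix e e' assume e: "e \<in> edges_of (L \<circ> \<pi>)" "e' \<in> edges_of (L \<circ> \<pi>)" "e \<noteq> e'"
  have "relabel (inv \<pi>) (relabel \<pi> d) = d" if "d \<in> edges_of (L \<circ> \<pi>)" for d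
    using relabel_inverse[OF that] bij by (simp add: bij_def)
  then have "relabel \<pi> e \<noteq> relabel \<pi> e'" using e by metis
  then obtain c where c: "edge_colouring L c" "c (relabel \<pi> e) \<noteq> c (relabel \<pi> e')"
    using separated_pullback[OF pos assms star_map_relabel[OF bij] e(1,2)] by blast
  with star_map_colouring[OF star_map_relabel[OF bij] c(1)]
  show "\<exists>c. edge_colouring (L \<circ> \<pi>) c \<and> c e \<noteq> c e'" by (intro exI[of _ "c \<circ> relabel \<pi>"]) auto
qed

end

section \<open>Lengthening a path\<close>

text \<open>
  Between steps \<open>i - 1\<close> and \<open>i\<close> of \<open>p\<close> a new step is inserted, with the colour of the half-edge between
  them. It becomes step \<open>i\<close>, and the two half-edges at its ends repeat the colours of the old steps \<open>i\<close>
  and \<open>i - 1\<close>.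
\<close>

fun insert_map :: "theta_path \<Rightarrow> nat \<Rightarrow> theta_edge \<Rightarrow> theta_edge" where
  "insert_map p i (Step q j) = (if q \<noteq> p \<or> j < i then Step q j
     else if j = i then Half (Inner p i) else Step p (j - 1))"
| "insert_map p i (Half (Inner q j)) = (if q \<noteq> p \<or> j < i then Half (Inner q j)
     else if j = i then Step p i else if j = Suc i then Step p (i - 1) else Half (Inner p (j - 1)))"
| "insert_map p i e = e"

text \<open>A right inverse of \<open>insert_map\<close> on edges. In the other order the
  composition moves only the half-edges at the two ends of the new step, each to the old step whose
  colour it repeats.\<close>

fun insert_section :: "theta_path \<Rightarrow> nat \<Rightarrow> theta_edge \<Rightarrow> theta_edge" where
  "insert_section p i (Step q j) = (if q \<noteq> p \<or> j < i then Step q j else Step p (Suc j))"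
| "insert_section p i (Half (Inner q j)) = (if q \<noteq> p \<or> j < i then Half (Inner q j)
     else if j = i then Step p i else Half (Inner p (Suc j)))"
| "insert_section p i e = e"

fun insert_vertex :: "theta_path \<Rightarrow> nat \<Rightarrow> theta_vertex \<Rightarrow> theta_vertex" where
  "insert_vertex p i (Inner q j) = (if q \<noteq> p \<or> j \<le> i then Inner q j else Inner p (j - 1))"
| "insert_vertex p i x = x"

context
  fixes L L' :: lengths and p :: theta_path and i :: nat
  assumes pos: "positive L" and i: "0 < i" "i < L p"
  defines "L' \<equiv> L(p := Suc (L p))"
begin

lemma insert_map_star:
  assumes "x \<in> vertices_of L'"
  shows "inj_on (insert_map p i) (star L' x)" (is ?inj)
    and "insert_map p i ` star L' x = star L (insert_vertex p i x)" (is ?img)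
    and "insert_vertex p i x \<in> vertices_of L"
proof -
  have "?inj \<and> ?img \<and> insert_vertex p i x \<in> vertices_of L"
  proof (cases x)
    case Source then show ?thesis using i
      by (auto simp: L'_def inj_on_def vertices_of_def image_image)
  next
    case Sink
    have e: "insert_map p i (Step q (L' q - 1)) = Step q (L q - 1)" for q
      using i unfolding L'_def by auto
    have "?img" unfolding Sink insert_vertex.simps star.simps image_image e ..
    moreover have "?inj" unfolding Sink star.simps
    proof (rule inj_onI)
      fix d d' assume d: "d \<in> range (\<lambda>q. Step q (L' q - 1))" "d' \<in> range (\<lambda>q. Step q (L' q - 1))"
        and eq: "insert_map p i d = insert_map p i d'"
      obtain q q' where q: "d = Step q (L' q - 1)" "d' = Step q' (L' q' - 1)" using d by blast
      from eq have "q = q'" unfolding q e by simp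
      then show "d = d'" unfolding q by simp
    qed
    ultimately show ?thesis using Sink by (simp add: vertices_of_def)
  next
    case (Inner q j) 
    have j: "0 < j" "j < L' q" using assms Inner by (auto simp: vertices_of_def)
    show ?thesis
    proof (cases "q \<noteq> p \<or> j < i")
      case True then show ?thesis using Inner i j 
        by (auto simp: L'_def vertices_of_def inj_on_def split: if_splits)
    next
      case F: False
      then consider "j = i" | "j = Suc i" | "j > Suc i" by linarith
      then show ?thesis
      proof cases
        case 1 then show ?thesis using Inner i j F
          by (auto simp: L'_def vertices_of_def inj_on_def)
      next
        case 2 then show ?thesis using Inner i j F
          by (auto simp: L'_def vertices_of_def inj_on_def)
      next
        case 3 
        then obtain t where "j = Suc (Suc (i + t))" using less_iff_Suc_add[of "Suc i" j] by auto
        then show ?thesis using Inner i j F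
          by (auto simp: L'_def vertices_of_def inj_on_def)
      qed
    qed
  qed
  then show ?inj ?img "insert_vertex p i x \<in> vertices_of L" by auto
qed

lemma star_map_insert: "star_map (insert_map p i) L' L"
  unfolding star_map_def using insert_map_star by blast

text \<open>The two ends of the new step have the same image, the vertex \<open>Inner p i\<close>,
  so a lift can avoid either of them.\<close>

lemma insert_vertex_lift:
  assumes "y \<in> vertices_of L"
  shows "\<exists>x\<in>vertices_of L'. x \<noteq> Inner p i \<and> insert_map p i ` star L' x = star L y"
    and "\<exists>x\<in>vertices_of L'. x \<noteq> Inner p (Suc i) \<and> insert_map p i ` star L' x = star L y"
proof -
  have "\<exists>x\<in>vertices_of L'. x \<noteq> Inner p k \<and> insert_vertex p i x = y" if k: "k = i \<or> k = Suc i" for k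
  proof (cases y)
    case (Inner q j)
    then have j: "0 < j" "j < L q" using assms by (auto simp: vertices_of_def)
    define j' where "j' = (if q \<noteq> p \<or> j < i then j else if j = i then (if k = i then Suc i else i) else Suc j)"
    have "Inner q j' \<in> vertices_of L'" "Inner q j' \<noteq> Inner p k" "insert_vertex p i (Inner q j') = y"
      using j k i unfolding j'_def Inner by (auto simp: vertices_of_def L'_def)
    then show ?thesis by blast
  qed (auto simp: vertices_of_def)
  then show "\<exists>x\<in>vertices_of L'. x \<noteq> Inner p i \<and> insert_map p i ` star L' x = star L y"
    and "\<exists>x\<in>vertices_of L'. x \<noteq> Inner p (Suc i) \<and> insert_map p i ` star L' x = star L y"
    using insert_map_star(2) by metis+
qed

text \<open>The steps \<open>i - 1\<close>, \<open>i\<close> and \<open>i + 1\<close> carry all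
  three colours here, so the half-edge at each end of the middle step repeats the step beyond the
  other end.\<close>

lemma turn_colours:
  assumes "edge_colouring L' c" "c (Step p (i - 1)) \<noteq> c (Step p (Suc i))"
  shows "c (Half (Inner p i)) = c (Step p (Suc i))" "c (Half (Inner p (Suc i))) = c (Step p (i - 1))"
proof -
  have "Inner p i \<in> vertices_of L'" "Inner p (Suc i) \<in> vertices_of L'"
    using i by (auto simp: vertices_of_def L'_def)
  then have "inj_on c (star L' (Inner p i))" "inj_on c (star L' (Inner p (Suc i)))"
    using assms(1) unfolding edge_colouring_def by blast+
  then have "c (Step p (i - 1)) \<noteq> c (Step p i)" "c (Half (Inner p i)) \<noteq> c (Step p (i - 1))"
     "c (Half (Inner p i)) \<noteq> c (Step p i)" "c (Step p (Suc i)) \<noteq> c (Step p i)" 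
     "c (Half (Inner p (Suc i))) \<noteq> c (Step p (Suc i))" "c (Half (Inner p (Suc i))) \<noteq> c (Step p i)"
    using i by (auto simp: inj_on_def)
  then show "c (Half (Inner p i)) = c (Step p (Suc i))" "c (Half (Inner p (Suc i))) = c (Step p (i - 1))"
    using assms(2) third_colour[of "c (Step p (i - 1))" "c (Step p i)" "c (Step p (Suc i))" "c (Half (Inner p i))"]
      third_colour[of "c (Step p (Suc i))" "c (Step p i)" "c (Step p (i - 1))" "c (Half (Inner p (Suc i)))"] by metis+
qed

text \<open>The colouring of the short graph is \<open>c \<circ> insert_section p i\<close>. Pulling
  it back can change \<open>c\<close> only at two half-edges, and there \<open>turn_colours\<close>
  shows that nothing changes.\<close>

lemma insert_factor:
  assumes "edge_colouring L' c" "c (Step p (i - 1)) \<noteq> c (Step p (Suc i))"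
  shows "\<exists>d. edge_colouring L d \<and> (\<forall>e\<in>edges_of L'. (d \<circ> insert_map p i) e = c e)"
proof (intro exI[of _ "c \<circ> insert_section p i"] conjI ballI)
  show eq: "((c \<circ> insert_section p i) \<circ> insert_map p i) e = c e" if e: "e \<in> edges_of L'" for e
  proof -
    consider q j where "e = Step q j" "j < L' q" | q j where "e = Half (Inner q j)" "0 < j" "j < L' q"
      using e unfolding edges_of_def by auto
    then show ?thesis
    proof cases
      case 1 then show ?thesis using i by auto
    next
      case 2
      consider "q \<noteq> p \<or> j < i" | "q = p" "j = i" | "q = p" "j = Suc i" | "q = p" "j > Suc i" by linarith
      then show ?thesis
      proof cases
        case b: 2
        then show ?thesis using 2(1) i turn_colours(1)[OF assms] by simp
      next
        case b: 3
        then show ?thesis using 2(1) i turn_colours(2)[OF assms] by simp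
      qed (use 2(1) i in auto)
    qed
  qed
  show "edge_colouring L (c \<circ> insert_section p i)"
    unfolding edge_colouring_def
  proof
    fix y assume "y \<in> vertices_of L"
    then obtain x where x: "x \<in> vertices_of L'" "insert_map p i ` star L' x = star L y"
      using insert_vertex_lift by blast
    have "star L' x \<subseteq> edges_of L'" using star_subset[OF _ x(1)] pos unfolding positive_def L'_def by simp
    moreover have "inj_on c (star L' x)" using assms(1) x unfolding edge_colouring_def by blast
    moreover from calculation(1) have "((c \<circ> insert_section p i) \<circ> insert_map p i) e = c e" if "e \<in> star L' x" for e
      using eq that by blast
    ultimately have "inj_on ((c \<circ> insert_section p i) \<circ> insert_map p i) (star L' x)"
      using inj_on_cong[of "star L' x" "(c \<circ> insert_section p i) \<circ> insert_map p i" c] by blast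
    then show "inj_on (c \<circ> insert_section p i) (star L y)"
      unfolding x(2)[symmetric] by (rule inj_on_imageI)
  qed
qed

end

lemma edges_of_cases [consumes 1, case_names step half]:
  assumes "e \<in> edges_of L"
  obtains (step) q j where "e = Step q j" "j < L q" | (half) q j where "e = Half (Inner q j)" "0 < j" "j < L q"
  using assms unfolding edges_of_def by blast

lemma insert_section_map:
  assumes "e \<in> edges_of L" "0 < i"
  shows "insert_section p i (insert_map p i e) = (if e = Half (Inner p i) then Step p (Suc i)
    else if e = Half (Inner p (Suc i)) then Step p (i - 1) else e)"
  using assms(1)
proof (cases rule: edges_of_cases)
  case (half q j)
  consider "q \<noteq> p \<or> j < i" | "q = p" "j = i" | "q = p" "j = Suc i" | "q = p" "j > Suc i" by linarith
  then show ?thesis using assms(2) half(1) by cases auto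
qed (use assms(2) in auto)

text \<open>Place 1 identifies \<open>Half (Inner p 1)\<close> with \<open>Step p 2\<close> and
  \<open>Half (Inner p 2)\<close> with \<open>Step p 0\<close>; place 2 identifies
  \<open>Half (Inner p 2)\<close> with \<open>Step p 3\<close> and \<open>Half (Inner p 3)\<close>
  with \<open>Step p 1\<close>. No pair occurs twice.\<close>

lemma insert_maps_separate:
  assumes "e \<in> edges_of L" "e' \<in> edges_of L" "insert_map p 1 e = insert_map p 1 e'" "insert_map p 2 e = insert_map p 2 e'"
  shows "e = e'"
proof -
  have "insert_section p i (insert_map p i e) = insert_section p i (insert_map p i e')" if "i = 1 \<or> i = 2" for i
    using assms(3,4) that by auto
  from this[of 1] this[of 2] show ?thesis
    by (auto simp: insert_section_map[OF assms(1)] insert_section_map[OF assms(2)] split: if_splits)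
qed

lemma separated_step:
  assumes "positive L" "3 \<le> L p" "separated L"
  shows "separated (L(p := Suc (L p)))"
  unfolding separated_def
proof (intro ballI impI)
  let ?L' = "L(p := Suc (L p))"
  fix e e' assume e: "e \<in> edges_of ?L'" "e' \<in> edges_of ?L'" "e \<noteq> e'"
  then obtain i where i: "i = 1 \<or> i = 2" "insert_map p i e \<noteq> insert_map p i e'"
    using insert_maps_separate by metis
  have g: "star_map (insert_map p i) ?L' L" using star_map_insert[OF assms(1)] i(1) assms(2) by auto
  obtain c where "edge_colouring L c" "c (insert_map p i e) \<noteq> c (insert_map p i e')"
    using separated_pullback[OF assms(1,3) g e(1,2) i(2)] by blast
  with star_map_colouring[OF g] show "\<exists>c. edge_colouring ?L' c \<and> c e \<noteq> c e'"
    by (intro exI[of _ "c \<circ> insert_map p i"]) simp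
qed

text \<open>
  Colourings of \<open>p\<close> that start with \<open>abca\<close> come from a path that is shorter by three; the colours \<open>b\<close>
  and \<open>c\<close> are those of the first steps of the other two paths \<open>q\<close> and \<open>r\<close>.
\<close>

fun shortcut :: "theta_path \<Rightarrow> theta_path \<Rightarrow> theta_path \<Rightarrow> theta_edge \<Rightarrow> theta_edge" where
  "shortcut p q r (Step p' j) = (if p' \<noteq> p then Step p' j else if j = 0 then Step p 0
     else if j = 1 then Step q 0 else if j = 2 then Step r 0 else Step p (j - 3))"
| "shortcut p q r (Half (Inner p' j)) = (if p' \<noteq> p then Half (Inner p' j) else if j \<le> 1 then Step r 0
     else if j = 2 then Step p 0 else if j = 3 then Step q 0 else Half (Inner p (j - 3)))"
| "shortcut p q r e = e"

lemma range_three: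
  fixes p q r :: theta_path
  assumes "p \<noteq> q" "p \<noteq> r" "q \<noteq> r"
  shows "range f = {f p, f q, f r}"
proof -
  have "x \<in> {p, q, r}" for x
    by (insert assms, (cases p; cases q; cases r; cases x; simp))
  then have "UNIV = {p, q, r}" by blast
  from arg_cong[OF this, of "image f"] show ?thesis by (simp only: image_insert image_empty)
qed

text \<open>All stars have three edges, so mapping a star onto a star already forces
  injectivity.\<close>

lemma star_mapI:
  assumes "\<And>x. x \<in> vertices_of L' \<Longrightarrow> \<exists>y\<in>vertices_of L. g ` star L' x = star L y"
  shows "star_map g L' L"
  unfolding star_map_def
proof (intro ballI conjI)
  fix x assume x: "x \<in> vertices_of L'"
  then obtain y where y: "y \<in> vertices_of L" "g ` star L' x = star L y" using assms by blast
  then show "\<exists>y\<in>vertices_of L. g ` star L' x = star L y" by blast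
  have "card (g ` star L' x) = card (star L' x)" using card_star x y by simp
  then show "inj_on g (star L' x)" by (intro eq_card_imp_inj_on) auto
qed

text \<open>The stars at the first three inner vertices of \<open>p\<close> all go onto the star at
  the source. Length at least four makes these three vertices inner and leaves a path of positive
  length.\<close>

lemma star_map_shortcut:
  assumes "p \<noteq> q" "p \<noteq> r" "q \<noteq> r" "4 \<le> L p" "positive L"
  shows "star_map (shortcut p q r) L (L(p := L p - 3))" (is "star_map _ _ ?L")
proof (rule star_mapI)
  note three = range_three[OF assms(1-3)]
  fix x assume x: "x \<in> vertices_of L"
  show "\<exists>y\<in>vertices_of ?L. shortcut p q r ` star L x = star ?L y"
  proof (cases x)
    case Source
    then have "shortcut p q r ` star L x = star ?L Source" using assms(1-3) by (simp add: three)
    then show ?thesis by (auto simp: vertices_of_def)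
  next
    case Sink
    have "L p - 1 - 3 = L p - 3 - 1" "\<not> L p - 1 \<le> 2" using assms(4) by auto
    then have "shortcut p q r ` star L x = star ?L Sink" using Sink assms(1-3) by (auto simp add: three)
    then show ?thesis by (auto simp: vertices_of_def)
  next
    case (Inner p' j)
    then have j: "0 < j" "j < L p'" using x by (auto simp: vertices_of_def)
    show ?thesis
    proof (cases "p' = p \<and> j \<le> 3")
      case True
      then consider "j = 1" | "j = 2" | "j = 3" using j by linarith
      then have "shortcut p q r ` star L x = star ?L Source"
        using Inner True assms(1-3) by cases (auto simp: three)
      then show ?thesis by (auto simp: vertices_of_def)
    next
      case False
      then have "shortcut p q r ` star L x = star ?L (Inner p' (if p' = p then j - 3 else j))"
        using Inner j by auto
      moreover have "Inner p' (if p' = p then j - 3 else j) \<in> vertices_of ?L"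
        using False j by (auto simp: vertices_of_def)
      ultimately show ?thesis by blast
    qed
  qed
qed

text \<open>Colourings of \<open>p\<close> that start with \<open>abab\<close> come from a path that is shorter by two.\<close>

fun alternate :: "theta_path \<Rightarrow> theta_edge \<Rightarrow> theta_edge" where
  "alternate p (Step q j) = (if q \<noteq> p then Step q j else if j < 4 then Step p (j mod 2) else Step p (j - 2))"
| "alternate p (Half (Inner q j)) = (if q \<noteq> p then Half (Inner q j) else if j < 4 then Half (Inner p 1)
     else Half (Inner p (j - 2)))"
| "alternate p e = e"

text \<open>The stars at the first three inner vertices of \<open>p\<close> are all folded onto the
  star at \<open>Inner p 1\<close>.\<close>

lemma star_map_alternate:
  assumes "4 \<le> L p" "positive L"
  shows "star_map (alternate p) L (L(p := L p - 2))" (is "star_map _ _ ?L")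
proof (rule star_mapI)
  fix x assume x: "x \<in> vertices_of L"
  show "\<exists>y\<in>vertices_of ?L. alternate p ` star L x = star ?L y"
  proof (cases x)
    case Source
    then have "alternate p ` star L x = star ?L Source" by (auto simp: image_image)
    then show ?thesis by (auto simp: vertices_of_def)
  next
    case Sink
    have "alternate p (Step q (L q - 1)) = Step q (?L q - 1)" for q
    \<comment> \<open>For length four the last step is step 3, which is still folded and goes to
      step 1, the last step of the path of length two; otherwise it is shifted.\<close>
    proof (cases "q = p \<and> L p = 4")
      case True then show ?thesis by simp
    next
      case False
      then have "q = p \<Longrightarrow> \<not> L p - 1 < 4 \<and> L p - 1 - 2 = L p - 2 - 1" using assms by auto
      then show ?thesis by simp
    qed
    then have "alternate p ` star L x = star ?L Sink" using Sink by (simp only: star.simps image_image)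
    then show ?thesis by (auto simp: vertices_of_def)
  next
    case (Inner q j)
    then have j: "0 < j" "j < L q" using x by (auto simp: vertices_of_def)
    show ?thesis
    proof (cases "q = p \<and> j \<le> 3")
      case True
      then consider "j = 1" | "j = 2" | "j = 3" using j by linarith
      then have "alternate p ` star L x = star ?L (Inner p 1)"
        using Inner True by cases (auto simp: numeral_3_eq_3)
      moreover have "Inner p 1 \<in> vertices_of ?L" using assms by (auto simp: vertices_of_def)
      ultimately show ?thesis by blast
    next
      case False
      have "q = p \<Longrightarrow> alternate p (Step p (j - 1)) = Step p (j - 2 - 1)"
        using False j by (cases "j = 4") auto
      then have "alternate p ` star L x = star ?L (Inner q (if q = p then j - 2 else j))"
        using Inner j False by auto
      moreover have "Inner q (if q = p then j - 2 else j) \<in> vertices_of ?L"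
        using False j by (auto simp: vertices_of_def)
      ultimately show ?thesis by blast
    qed
  qed
qed

text \<open>
  Edges with the same colour in every colouring that has pairwise distinct colours on the first three
  steps of \<open>p\<close> and also on its second, third and fourth step.
\<close>

definition start_equivalent :: "theta_path \<Rightarrow> theta_edge \<Rightarrow> theta_edge \<Rightarrow> bool" where
  "start_equivalent p e e' \<longleftrightarrow> e = e' \<or>
     {e, e'} \<subseteq> {Step p 0, Half (Inner p 2), Step p 3} \<or>
     {e, e'} \<subseteq> {Step p 1, Half (Inner p 3)} \<or>
     {e, e'} \<subseteq> {Step p 2, Half (Inner p 1)}"

text \<open>One shortcut also identifies the edges coloured b with the first step of
  \<open>q\<close> and those coloured c with that of \<open>r\<close>. Exchanging \<open>q\<close>
  and \<open>r\<close> reverses this, so only the identifications inside the start of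
  \<open>p\<close> survive both.\<close>

lemma shortcuts_separate:
  assumes "p \<noteq> q" "p \<noteq> r" "q \<noteq> r" "e \<in> edges_of L" "e' \<in> edges_of L"
    and "shortcut p q r e = shortcut p q r e'" "shortcut p r q e = shortcut p r q e'"
  shows "start_equivalent p e e'"
  using assms(4)
proof (cases rule: edges_of_cases)
  case (step p1 j)
  show ?thesis using assms(5)
  proof (cases rule: edges_of_cases)
    case s: (step p2 j')
    show ?thesis using assms(1-3,6,7) unfolding step s start_equivalent_def by (auto split: if_splits)
  next
    case h: (half p2 j')
    show ?thesis using assms(1-3,6,7) h(2) unfolding step h(1) start_equivalent_def by (auto split: if_splits)
  qed
next
  case (half p1 j)
  show ?thesis using assms(5)
  proof (cases rule: edges_of_cases)
    case s: (step p2 j')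
    show ?thesis using assms(1-3,6,7) half(2) unfolding half(1) s start_equivalent_def by (auto split: if_splits)
  next
    case h: (half p2 j')
    show ?thesis using assms(1-3,6,7) half(2) h(2) unfolding half(1) h(1) start_equivalent_def by (auto split: if_splits)
  qed
qed


text \<open>Colourings pulled back along a shortcut start with abca and so satisfy both
  inequalities. Inequivalent edges have different images under one of the two shortcuts, and
  separation of the shorter graph then tells them apart.\<close>

lemma start_equivalentI:
  assumes pos: "positive L" and p: "4 \<le> L p" and sep: "separated (L(p := L p - 3))"
    and e: "e \<in> edges_of L" "e' \<in> edges_of L"
    and same: "\<And>c. \<lbrakk>edge_colouring L c; c (Step p 0) \<noteq> c (Step p 2); c (Step p 1) \<noteq> c (Step p 3)\<rbrakk> \<Longrightarrow> c e = c e'"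
  shows "start_equivalent p e e'"
proof (rule ccontr)
  assume neg: "\<not> start_equivalent p e e'"
  obtain q r where qr: "p \<noteq> q" "p \<noteq> r" "q \<noteq> r" by (metis theta_path.distinct)
  have "\<exists>q r. p \<noteq> q \<and> p \<noteq> r \<and> q \<noteq> r \<and> shortcut p q r e \<noteq> shortcut p q r e'"
  proof (cases "shortcut p q r e = shortcut p q r e'")
    case True
    then have "shortcut p r q e \<noteq> shortcut p r q e'" using shortcuts_separate[OF qr e] neg by blast
    then show ?thesis using qr by metis
  qed (use qr in blast)
  then obtain q r where qr: "p \<noteq> q" "p \<noteq> r" "q \<noteq> r" and ne: "shortcut p q r e \<noteq> shortcut p q r e'" by blast
  let ?L = "L(p := L p - 3)"
  have pos': "positive ?L" using pos p unfolding positive_def by simp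
  note g = star_map_shortcut[OF qr p pos]
  obtain c where c: "edge_colouring ?L c" "c (shortcut p q r e) \<noteq> c (shortcut p q r e')"
    using separated_pullback[OF pos' sep g e ne] by blast
  have "inj_on c (star ?L Source)" using c(1) unfolding edge_colouring_def vertices_of_def by blast
  then have "c (Step p 0) \<noteq> c (Step r 0)" "c (Step q 0) \<noteq> c (Step p 0)"
    using qr by (auto simp: range_three[OF qr])
  then have "(c \<circ> shortcut p q r) e = (c \<circ> shortcut p q r) e'"
    by (intro same[OF star_map_colouring[OF g c(1)]]) auto
  then show False using c(2) by simp
qed

section \<open>The dictating star after one lengthening\<close>

context
  fixes L L' :: lengths and p :: theta_path and f
  assumes pos: "positive L" and p: "3 \<le> L p" and dict: "dictatorial L"
    and sep: "separated (L(p := L p - 2))"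
    and col: "\<exists>c. edge_colouring (L(p := L p - 1)) c"
    and long: "\<exists>q. q \<noteq> p \<and> 1 < L q"
  defines "L' \<equiv> L(p := Suc (L p))"
  assumes f: "complex_colouring L' f"
begin

lemma pos': "positive L'"
  using pos unfolding positive_def L'_def by simp

lemma same_class:
  assumes "edge_colouring L' c" "f (colour_class L' c a) = f (colour_class L' c b)"
  shows "a = b"
proof -
  have "inj (\<lambda>a. f (colour_class L' c a))" using f assms(1) unfolding complex_colouring_def by blast
  from injD[OF this, of a b] show ?thesis using assms(2) by simp
qed

text \<open>Avoiding \<open>Inner p k\<close> costs nothing, by \<open>insert_vertex_lift\<close>,
  and cuts down the pairs of stars to be compared later.\<close>

lemma insert_dictator:
  assumes "i = 1 \<or> i = 2" "k = i \<or> k = Suc i"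
  shows "\<exists>x s. x \<in> vertices_of L' \<and> x \<noteq> Inner p k \<and> bij_betw s UNIV (star L' x) \<and>
    (\<forall>c. edge_colouring L' c \<and> c (Step p (i - 1)) \<noteq> c (Step p (Suc i)) \<longrightarrow> dictates L' f s c)"
proof -
  have i: "0 < i" "i < L p" using assms(1) p by auto
  have lift: "\<exists>x\<in>vertices_of L'. x \<noteq> Inner p k \<and> insert_map p i ` star L' x = star L y" if "y \<in> vertices_of L" for y
    using insert_vertex_lift[OF pos i that] assms(2) unfolding L'_def by blast
  have g: "star_map (insert_map p i) L' L" using star_map_insert[OF pos i] unfolding L'_def .
  obtain x s where x: "x\<in>vertices_of L'" "x \<noteq> Inner p k" "bij_betw s UNIV (star L' x)"
    and d: "\<And>c. edge_colouring L c \<Longrightarrow> dictates L' f s (c \<circ> insert_map p i)"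
    using dictator_pullback[OF pos dict g f lift] by blast
  have s: "star_enum L' s" using x unfolding star_enum_def by blast
  have "dictates L' f s c" if c: "edge_colouring L' c" "c (Step p (i - 1)) \<noteq> c (Step p (Suc i))" for c
  proof -
    obtain b where "edge_colouring L b" "\<forall>e\<in>edges_of L'. (b \<circ> insert_map p i) e = c e"
      using insert_factor[OF pos i] c unfolding L'_def by blast
    then show ?thesis using dictates_cong[OF pos' s _ d] by blast
  qed
  with x show ?thesis by blast
qed

text \<open>The length of \<open>p\<close> in \<open>L'\<close> is at least four, so
  \<open>Step p 1\<close> does not meet the sink.\<close>

lemma start_vertex:
  assumes "x \<in> vertices_of L'" "Step p 1 \<in> star L' x \<or> Half (Inner p 3) \<in> star L' x"
  shows "x \<in> {Inner p 1, Inner p 2, Inner p 3}"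
  using assms p by (cases x) (auto simp: L'_def vertices_of_def)

lemma inner_vertices: "Inner p 1 \<in> vertices_of L'" "Inner p 2 \<in> vertices_of L'" "Inner p 3 \<in> vertices_of L'"
  using p by (auto simp: L'_def vertices_of_def)

lemma start_colours:
  assumes "edge_colouring L' c"
  shows "c (Step p 0) \<noteq> c (Step p 1)" "c (Step p 1) \<noteq> c (Step p 2)" "c (Step p 2) \<noteq> c (Step p 3)"
    "c (Half (Inner p 1)) \<notin> {c (Step p 0), c (Step p 1)}"
    "c (Half (Inner p 2)) \<notin> {c (Step p 1), c (Step p 2)}"
    "c (Half (Inner p 3)) \<notin> {c (Step p 2), c (Step p 3)}"
proof -
  have "inj_on c (star L' (Inner p 1))" "inj_on c (star L' (Inner p 2))" "inj_on c (star L' (Inner p 3))"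
    using assms inner_vertices unfolding edge_colouring_def by blast+
  then show "c (Step p 0) \<noteq> c (Step p 1)" "c (Step p 1) \<noteq> c (Step p 2)" "c (Step p 2) \<noteq> c (Step p 3)"
    "c (Half (Inner p 1)) \<notin> {c (Step p 0), c (Step p 1)}"
    "c (Half (Inner p 2)) \<notin> {c (Step p 1), c (Step p 2)}"
    "c (Half (Inner p 3)) \<notin> {c (Step p 2), c (Step p 3)}"
    by (auto simp: inj_on_def numeral_2_eq_2 numeral_3_eq_3)
qed

text \<open>
  If the first four steps of \<open>p\<close> are coloured \<open>abab\<close>, exchanging \<open>b\<close> with the third colour around the
  second step keeps the class of \<open>a\<close>, and exchanging \<open>a\<close> with the third colour around the third step
  keeps the class of \<open>b\<close>.
\<close>

lemma alternating_neighbours: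
  assumes c: "edge_colouring L' c" and alt: "c (Step p 0) = c (Step p 2)" "c (Step p 1) = c (Step p 3)"
  obtains c1 c2 where "edge_colouring L' c1" "c1 (Step p 1) \<noteq> c1 (Step p 3)" "c1 (Step p 0) = c (Step p 0)"
      "colour_class L' c1 (c (Step p 0)) = colour_class L' c (c (Step p 0))"
    and "edge_colouring L' c2" "c2 (Step p 0) \<noteq> c2 (Step p 2)" "c2 (Step p 3) = c (Step p 1)"
      "colour_class L' c2 (c (Step p 1)) = colour_class L' c (c (Step p 1))"
proof -
  note st = start_colours[OF c]
  define c1 where "c1 = c(Step p 1 := c (Half (Inner p 1)), Half (Inner p 1) := c (Step p 1), Half (Inner p 2) := c (Step p 1))"
  define c2 where "c2 = c(Step p 2 := c (Half (Inner p 2)), Half (Inner p 2) := c (Step p 2), Half (Inner p 3) := c (Step p 2))"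
  have h: "c (Half (Inner p 2)) = c (Half (Inner p 1))" "c (Half (Inner p 3)) = c (Half (Inner p 2))"
    using st alt third_colour[of "c (Step p 0)" "c (Step p 1)" "c (Half (Inner p 1))" "c (Half (Inner p 2))"]
      third_colour[of "c (Step p 0)" "c (Step p 1)" "c (Half (Inner p 2))" "c (Half (Inner p 3))"] by auto
  have inj: "inj_on c (star L' x)" if "x \<in> vertices_of L'" for x
    using c that unfolding edge_colouring_def by blast
  have disj: "star L' x \<inter> {Step p 1, Half (Inner p 1), Half (Inner p 2)} = {}"
    if "x \<in> vertices_of L'" "x \<noteq> Inner p 1" "x \<noteq> Inner p 2" for x
    using that p by (cases x) (auto simp: L'_def vertices_of_def)
  have disj': "star L' x \<inter> {Step p 2, Half (Inner p 2), Half (Inner p 3)} = {}"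
    if "x \<in> vertices_of L'" "x \<noteq> Inner p 2" "x \<noteq> Inner p 3" for x
    using that p by (cases x) (auto simp: L'_def vertices_of_def)
  have "edge_colouring L' c1" unfolding edge_colouring_def
  proof
    fix x assume x: "x \<in> vertices_of L'"
    consider "x = Inner p 1" | "x = Inner p 2" | "x \<noteq> Inner p 1" "x \<noteq> Inner p 2" by blast
    then show "inj_on c1 (star L' x)"
    proof cases
      case 1 then show ?thesis using st by (auto simp: c1_def inj_on_def)
    next
      case 2 then show ?thesis using st h by (auto simp: c1_def inj_on_def numeral_2_eq_2)
    next
      case 3
      have "c1 e = c e" if "e \<in> star L' x" for e using disj[OF x 3] that unfolding c1_def by auto
      then show ?thesis using inj[OF x] inj_on_cong[of "star L' x" c1 c] by blast
    qed
  qed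
  moreover have "edge_colouring L' c2" unfolding edge_colouring_def
  proof
    fix x assume x: "x \<in> vertices_of L'"
    consider "x = Inner p 2" | "x = Inner p 3" | "x \<noteq> Inner p 2" "x \<noteq> Inner p 3" by blast
    then show "inj_on c2 (star L' x)"
    proof cases
      case 1 then show ?thesis using st by (auto simp: c2_def inj_on_def numeral_2_eq_2)
    next
      case 2 then show ?thesis using st h by (auto simp: c2_def inj_on_def numeral_2_eq_2 numeral_3_eq_3)
    next
      case 3
      have "c2 e = c e" if "e \<in> star L' x" for e using disj'[OF x 3] that unfolding c2_def by auto
      then show ?thesis using inj[OF x] inj_on_cong[of "star L' x" c2 c] by blast
    qed
  qed
  moreover have "colour_class L' c1 (c (Step p 0)) = colour_class L' c (c (Step p 0))"
    using st h alt unfolding colour_class_def c1_def by auto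
  moreover have "colour_class L' c2 (c (Step p 1)) = colour_class L' c (c (Step p 1))"
    using st h alt unfolding colour_class_def c2_def by auto
  moreover have "c1 (Step p 1) \<noteq> c1 (Step p 3)" "c1 (Step p 0) = c (Step p 0)"
    "c2 (Step p 0) \<noteq> c2 (Step p 2)" "c2 (Step p 3) = c (Step p 1)"
    using st h alt unfolding c1_def c2_def by auto
  ultimately show ?thesis using that[of c1 c2] by blast
qed

text \<open>On the common colourings both edges with index \<open>a\<close> lie in the class that
  \<open>f\<close> sends to \<open>a\<close>, so they have the same colour.\<close>

lemma insert_dictators_agree:
  assumes "\<And>c. \<lbrakk>edge_colouring L' c; c (Step p 0) \<noteq> c (Step p 2)\<rbrakk> \<Longrightarrow> dictates L' f s1 c"
    and "\<And>c. \<lbrakk>edge_colouring L' c; c (Step p 1) \<noteq> c (Step p 3)\<rbrakk> \<Longrightarrow> dictates L' f s2 c"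
    and "star_enum L' s1" "star_enum L' s2"
  shows "start_equivalent p (s1 a) (s2 a)"
proof (rule start_equivalentI[OF pos'])
  show "4 \<le> L' p" using p by (simp add: L'_def)
  show "separated (L'(p := L' p - 3))" using sep by (simp add: L'_def)
  show "s1 a \<in> edges_of L'" "s2 a \<in> edges_of L'"
    using star_enum_range[OF pos'] assms(3,4) by blast+
  fix c assume "edge_colouring L' c" "c (Step p 0) \<noteq> c (Step p 2)" "c (Step p 1) \<noteq> c (Step p 3)"
  then show "c (s1 a) = c (s2 a)" using assms(1,2) same_class unfolding dictates_def by metis
qed

text \<open>The star from place 1 is taken off \<open>Inner p 1\<close> and the one from place 2 off
  \<open>Inner p 3\<close>. If they still differ near the start of \<open>p\<close>, forced colours
  let one replace the other, or a colouring starting with abab gives a contradiction; away from it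
  they coincide.\<close>

lemma joint_dictator:
  obtains s where "star_enum L' s"
    "\<And>c. \<lbrakk>edge_colouring L' c; c (Step p 0) \<noteq> c (Step p 2) \<or> c (Step p 1) \<noteq> c (Step p 3)\<rbrakk> \<Longrightarrow> dictates L' f s c"
proof -
  obtain x1 s1 where x1: "x1 \<in> vertices_of L'" "x1 \<noteq> Inner p 1" and b1: "bij_betw s1 UNIV (star L' x1)"
    and "\<forall>c. edge_colouring L' c \<and> c (Step p (1 - 1)) \<noteq> c (Step p (Suc 1)) \<longrightarrow> dictates L' f s1 c"
    using insert_dictator[of 1 1] by auto
  then have d1: "\<And>c. \<lbrakk>edge_colouring L' c; c (Step p 0) \<noteq> c (Step p 2)\<rbrakk> \<Longrightarrow> dictates L' f s1 c"
    by (simp add: numeral_2_eq_2)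
  obtain x2 s2 where x2: "x2 \<in> vertices_of L'" "x2 \<noteq> Inner p 3" and b2: "bij_betw s2 UNIV (star L' x2)"
    and "\<forall>c. edge_colouring L' c \<and> c (Step p (2 - 1)) \<noteq> c (Step p (Suc 2)) \<longrightarrow> dictates L' f s2 c"
    using insert_dictator[of 2 3] by auto
  then have d2: "\<And>c. \<lbrakk>edge_colouring L' c; c (Step p 1) \<noteq> c (Step p 3)\<rbrakk> \<Longrightarrow> dictates L' f s2 c"
    by (simp add: numeral_3_eq_3)
  have s1: "star_enum L' s1" and s2: "star_enum L' s2" using x1 x2 b1 b2 unfolding star_enum_def by auto
  have r1: "range s1 = star L' x1" and r2: "range s2 = star L' x2" using b1 b2 unfolding bij_betw_def by auto
  have eqv: "start_equivalent p (s1 a) (s2 a)" for a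
    by (rule insert_dictators_agree[OF d1 d2 s1 s2])
  have m1: "s1 a \<in> star L' x1" and m2: "s2 a \<in> star L' x2" for a using r1 r2 by blast+
  have t1: "c (Half (Inner p 1)) = c (Step p 2)" "c (Half (Inner p 2)) = c (Step p 0)"
    if "edge_colouring L' c" "c (Step p 0) \<noteq> c (Step p 2)" for c
    using turn_colours[OF pos, of 1 p c] that p unfolding L'_def by (auto simp: numeral_2_eq_2)
  have t2: "c (Half (Inner p 2)) = c (Step p 3)" "c (Half (Inner p 3)) = c (Step p 1)"
    if "edge_colouring L' c" "c (Step p 1) \<noteq> c (Step p 3)" for c
    using turn_colours[OF pos, of 2 p c] that p unfolding L'_def by (auto simp: numeral_2_eq_2 numeral_3_eq_3)
  have transfer: "dictates L' f s' c" if "\<And>a. c (s a) = c (s' a)" "dictates L' f s c" for s s' c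
    using that unfolding dictates_def by simp
  have star1: "star L' (Inner p 1) = {Step p 0, Step p 1, Half (Inner p 1)}"
    and star2: "star L' (Inner p 2) = {Step p 1, Step p 2, Half (Inner p 2)}"
    and star3: "star L' (Inner p 3) = {Step p 2, Step p 3, Half (Inner p 3)}"
    by (simp_all add: numeral_2_eq_2 numeral_3_eq_3)
  let ?T = "{Inner p 1, Inner p 2, Inner p 3}"
  \<comment> \<open>Each of the three stars contains \<open>Step p 1\<close> or
    \<open>Half (Inner p 3)\<close>. These two edges form a full equivalence class, and no star
    elsewhere meets it.\<close>
  have both: "x1 \<in> ?T \<longleftrightarrow> x2 \<in> ?T"
  proof
    assume "x1 \<in> ?T"
    then have "Step p 1 \<in> range s1 \<or> Half (Inner p 3) \<in> range s1" unfolding r1 using star1 star2 star3 by auto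
    then obtain a where "s1 a \<in> {Step p 1, Half (Inner p 3)}" by (metis insertCI rangeE)
    then have "s2 a \<in> {Step p 1, Half (Inner p 3)}" using eqv[of a] unfolding start_equivalent_def by auto
    then show "x2 \<in> ?T" using start_vertex[OF x2(1)] m2[of a] by auto
  next
    assume "x2 \<in> ?T"
    then have "Step p 1 \<in> range s2 \<or> Half (Inner p 3) \<in> range s2" unfolding r2 using star1 star2 star3 by auto
    then obtain a where "s2 a \<in> {Step p 1, Half (Inner p 3)}" by (metis insertCI rangeE)
    then have "s1 a \<in> {Step p 1, Half (Inner p 3)}" using eqv[of a] unfolding start_equivalent_def by auto
    then show "x1 \<in> ?T" using start_vertex[OF x1(1)] m1[of a] by auto
  qed
  consider "x1 = Inner p 2" "x2 = Inner p 2" | "x1 = Inner p 2" "x2 = Inner p 1" | "x1 = Inner p 3" "x2 = Inner p 2"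
    | "x1 = Inner p 3" "x2 = Inner p 1" | "x1 \<notin> ?T" "x2 \<notin> ?T"
    using both x1(2) x2(2) by blast
  then show ?thesis
  proof cases
    case 1
    \<comment> \<open>The three edges at \<open>Inner p 2\<close> lie in three different equivalence
      classes.\<close>
    have "s1 a = s2 a" for a
      using eqv[of a] m1[of a] m2[of a] unfolding 1 star2 start_equivalent_def by auto
    then have "s1 = s2" by blast
    then show ?thesis using that[OF s1] d1 d2 by blast
  next
    case 2
    \<comment> \<open>The corresponding edges at \<open>Inner p 2\<close> and
      \<open>Inner p 1\<close> have equal colours whenever steps 0 and 2 differ, by the forced
      half-edges, so \<open>s2\<close> serves these colourings as well.\<close>
    have "c (s1 a) = c (s2 a)" if "edge_colouring L' c" "c (Step p 0) \<noteq> c (Step p 2)" for a c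
      using eqv[of a] m1[of a] m2[of a] t1[OF that] unfolding 2 star2 star1 start_equivalent_def by auto
    then have "dictates L' f s2 c" if "edge_colouring L' c" "c (Step p 0) \<noteq> c (Step p 2)" for c
      using transfer[OF _ d1] that by blast
    then show ?thesis using that[OF s2] d2 by blast
  next
    case 3
    have "c (s2 a) = c (s1 a)" if "edge_colouring L' c" "c (Step p 1) \<noteq> c (Step p 3)" for a c
      using eqv[of a] m1[of a] m2[of a] t2[OF that] unfolding 3 star2 star3 start_equivalent_def by auto
    then have "dictates L' f s1 c" if "edge_colouring L' c" "c (Step p 1) \<noteq> c (Step p 3)" for c
      using transfer[OF _ d2] that by blast
    then show ?thesis using that[OF s1] d1 by blast
  next
    case 4
    \<comment> \<open>This combination is impossible. In a colouring starting with abab, the class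
      of a survives in \<open>c1\<close>, where \<open>s2\<close> sees it through step 0, and the
      class of b survives in \<open>c2\<close>, where \<open>s1\<close> sees it through step 3. Both
      edges have the same index, so \<open>f\<close> would give two classes one value.\<close>
    obtain b where b: "edge_colouring (L(p := L p - 1)) b" using col by blast
    have "star_map (alternate p) L' (L'(p := L' p - 2))"
      using star_map_alternate[OF _ pos', of p] p by (simp add: L'_def)
    then have g: "star_map (alternate p) L' (L(p := L p - 1))" by (simp add: L'_def)
    define c where "c = b \<circ> alternate p"
    have c: "edge_colouring L' c" using star_map_colouring[OF g b] unfolding c_def .
    have "c (Step p 0) = c (Step p 2)" "c (Step p 1) = c (Step p 3)"
      by (simp_all add: c_def numeral_3_eq_3)
    from alternating_neighbours[OF c this] obtain c1 c2 where
      c1: "edge_colouring L' c1" "c1 (Step p 1) \<noteq> c1 (Step p 3)" "c1 (Step p 0) = c (Step p 0)"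
      "colour_class L' c1 (c (Step p 0)) = colour_class L' c (c (Step p 0))"
      and c2: "edge_colouring L' c2" "c2 (Step p 0) \<noteq> c2 (Step p 2)" "c2 (Step p 3) = c (Step p 1)"
      "colour_class L' c2 (c (Step p 1)) = colour_class L' c (c (Step p 1))" by metis
    have "Step p 0 \<in> range s2" unfolding r2 4 star1 by simp
    then obtain a where a: "s2 a = Step p 0" by (metis rangeE)
    have "s1 a = Step p 3"
      using eqv[of a] m1[of a] unfolding a 4 star3 start_equivalent_def by auto
    then have "f (colour_class L' c (c (Step p 1))) = a"
      using d1[OF c2(1,2)] c2(3,4) unfolding dictates_def by metis
    moreover have "f (colour_class L' c (c (Step p 0))) = a"
      using d2[OF c1(1,2)] c1(3,4) a unfolding dictates_def by metis
    ultimately have "c (Step p 0) = c (Step p 1)" using same_class[OF c] by metis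
    then show ?thesis using start_colours[OF c] by blast
  next
    case 5
    have out: "e \<notin> {Step p 1, Half (Inner p 3)}" "e \<notin> {Step p 2, Half (Inner p 1)}" "e \<noteq> Half (Inner p 2)"
      if "e \<in> star L' x" "x \<in> vertices_of L'" "x \<notin> ?T" for e x
      using that p by (cases x; force simp: L'_def vertices_of_def)+
    \<comment> \<open>Outside the start only steps 0 and 3 can be confused, which would match the
      star at the source with one containing step 3. The first step of a second path
      \<open>q\<close> is equivalent only to itself, so it would lie in both stars; since
      \<open>q\<close> has length at least two, it does not reach the sink.\<close>
    have ends: False if xy: "x \<in> vertices_of L'" "y \<in> vertices_of L'" "x \<notin> ?T" "y \<notin> ?T"
      and "Step p 0 \<in> star L' x" "Step p 3 \<in> star L' y" and s: "range s = star L' x" "range t = star L' y"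
      and st: "\<And>a. start_equivalent p (s a) (t a)" for x y s t
    proof -
      have "x = Source" using that p by (cases x) (auto simp: L'_def vertices_of_def)
      obtain q where q: "q \<noteq> p" "1 < L q" using long by blast
      have "Step q 0 \<in> range s" unfolding s \<open>x = Source\<close> by simp
      then obtain a where "s a = Step q 0" by (metis rangeE)
      then have "t a = Step q 0" using st[of a] q(1) unfolding start_equivalent_def by auto
      then have "Step q 0 \<in> star L' y" using s(2) by (metis rangeI)
      then show False using \<open>Step p 3 \<in> star L' y\<close> q p xy(2) by (cases y) (auto simp: L'_def vertices_of_def)
    qed
    have "start_equivalent p (s2 a) (s1 a)" for a
      using eqv[of a] unfolding start_equivalent_def by auto
    have "s1 a = s2 a" for a
    proof (rule ccontr)
      assume "s1 a \<noteq> s2 a"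
      then have "s1 a = Step p 0 \<and> s2 a = Step p 3 \<or> s1 a = Step p 3 \<and> s2 a = Step p 0"
        using eqv[of a] out[OF m1 x1(1) 5(1)] out[OF m2 x2(1) 5(2)] unfolding start_equivalent_def by auto
      then show False
        using ends[OF x1(1) x2(1) 5 _ _ r1 r2 eqv] ends[OF x2(1) x1(1) 5(2,1) _ _ r2 r1 \<open>\<And>a. start_equivalent p (s2 a) (s1 a)\<close>]
          m1[of a] m2[of a] by metis
    qed
    then have "s1 = s2" by blast
    then show ?thesis using that[OF s1] d1 d2 by blast
  qed
qed

text \<open>For abab, the class of a is taken from one neighbouring colouring and the class of b
  from the other. The value on the third class is then forced by injectivity.\<close>

lemma dictator_exists: "\<exists>s. star_enum L' s \<and> (\<forall>c. edge_colouring L' c \<longrightarrow> dictates L' f s c)"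
proof -
  obtain s where s: "star_enum L' s"
    "\<And>c. \<lbrakk>edge_colouring L' c; c (Step p 0) \<noteq> c (Step p 2) \<or> c (Step p 1) \<noteq> c (Step p 3)\<rbrakk> \<Longrightarrow> dictates L' f s c"
    using joint_dictator by blast
  have "dictates L' f s c" if c: "edge_colouring L' c" for c
  proof (cases "c (Step p 0) \<noteq> c (Step p 2) \<or> c (Step p 1) \<noteq> c (Step p 3)")
    case True then show ?thesis using s(2)[OF c] by blast
  next
    case False
    then have "c (Step p 0) = c (Step p 2)" "c (Step p 1) = c (Step p 3)" by auto
    from alternating_neighbours[OF c this] obtain c1 c2 where
      c1: "edge_colouring L' c1" "c1 (Step p 1) \<noteq> c1 (Step p 3)"
      "colour_class L' c1 (c (Step p 0)) = colour_class L' c (c (Step p 0))"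
      and c2: "edge_colouring L' c2" "c2 (Step p 0) \<noteq> c2 (Step p 2)"
      "colour_class L' c2 (c (Step p 1)) = colour_class L' c (c (Step p 1))" by metis
    \<comment> \<open>A class shared by \<open>b\<close> and \<open>c\<close> contains the same edge
      of the star in both colourings, so its value under \<open>f\<close> carries over.\<close>
    have keep: "f (colour_class L' c (c (s a))) = a" if a: "c (s a) = t" and b: "edge_colouring L' b" "dictates L' f s b"
        "colour_class L' b t = colour_class L' c t" for a b t
    proof -
      have "s a \<in> colour_class L' c t" using a star_enum_range[OF pos' s(1)] unfolding colour_class_def by auto
      then have "s a \<in> colour_class L' b t" unfolding b(3) .
      then have "b (s a) = t" by (simp add: colour_class_def)
      moreover have "f (colour_class L' b (b (s a))) = a" using b(2) unfolding dictates_def by blast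
      ultimately show ?thesis using a b(3) by simp
    qed
    note surj = inj_endo_surj[OF star_enum_inj[OF s(1) c]]
    obtain a where a: "c (s a) = c (Step p 0)" using surj by (metis surjD)
    obtain b where b: "c (s b) = c (Step p 1)" using surj by (metis surjD)
    have "a \<noteq> b" using start_colours(1)[OF c] a b by auto
    have "inj (\<lambda>a. f (colour_class L' c (c (s a))))"
      using same_class[OF c] star_enum_inj[OF s(1) c] unfolding inj_def by blast
    moreover have "f (colour_class L' c (c (s a))) = a" using keep[OF a c1(1) s(2)[OF c1(1)] c1(3)] c1(2) by blast
    moreover have "f (colour_class L' c (c (s b))) = b" using keep[OF b c2(1) s(2)[OF c2(1)] c2(3)] c2(2) by blast
    ultimately have "(\<lambda>a. f (colour_class L' c (c (s a)))) = (\<lambda>a. a)"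
      by (intro colour_perm_eq[OF _ _ \<open>a \<noteq> b\<close>]) auto
    then show ?thesis unfolding dictates_def by metis
  qed
  with s(1) show ?thesis by blast
qed

end

text \<open>With n the new length of \<open>p\<close>, separation is asked for at n - 3, to compare
  the two stars, and a colouring at n - 2, to produce one that starts with abab.\<close>

theorem dictatorial_step:
  assumes "positive L" "3 \<le> L p" "dictatorial L" "separated (L(p := L p - 2))"
    and "\<exists>c. edge_colouring (L(p := L p - 1)) c" "\<exists>q. q \<noteq> p \<and> 1 < L q"
  shows "dictatorial (L(p := Suc (L p)))"
  unfolding dictatorial_def using dictator_exists[OF assms] by blast

section \<open>Search for colourings of the complex\<close>

text \<open>
  Colourings are normalised to be red, green and blue on the first steps of the three paths.
\<close>

fun other_colours :: "colour \<Rightarrow> colour list" where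
  "other_colours Red = [Green, Blue]"
| "other_colours Green = [Red, Blue]"
| "other_colours Blue = [Red, Green]"

text \<open>The number counts transitions: the words have one letter more, which is why
  \<open>theta_words\<close> passes lengths minus one.\<close>

primrec walks :: "nat \<Rightarrow> colour \<Rightarrow> colour list list" where
  "walks 0 x = [[x]]"
| "walks (Suc n) x = map (Cons x) (concat (map (walks n) (other_colours x)))"

type_synonym words = "colour list \<times> colour list \<times> colour list"

fun sinks_distinct :: "words \<Rightarrow> bool" where
  "sinks_distinct (u, v, w) \<longleftrightarrow> last u \<noteq> last v \<and> last u \<noteq> last w \<and> last v \<noteq> last w"

definition theta_words :: "nat \<Rightarrow> nat \<Rightarrow> nat \<Rightarrow> words list" where
  "theta_words k l m = filter sinks_distinct
     (List.product (walks (k - 1) Red) (List.product (walks (l - 1) Green) (walks (m - 1) Blue)))"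

definition third :: "colour \<Rightarrow> colour \<Rightarrow> colour" where
  "third x y = (if x \<noteq> Red \<and> y \<noteq> Red then Red else if x \<noteq> Green \<and> y \<noteq> Green then Green else Blue)"

fun path_word :: "words \<Rightarrow> theta_path \<Rightarrow> colour list" where
  "path_word (u, v, w) PathU = u"
| "path_word (u, v, w) PathV = v"
| "path_word (u, v, w) PathW = w"

text \<open>The last two equations are default values, since the branch vertices carry no
  half-edge.\<close>

fun word_colouring :: "words \<Rightarrow> theta_edge \<Rightarrow> colour" where
  "word_colouring W (Step p i) = path_word W p ! i"
| "word_colouring W (Half (Inner p i)) = third (path_word W p ! (i - 1)) (path_word W p ! i)"
| "word_colouring W (Half Source) = Red"
| "word_colouring W (Half Sink) = Red"

section \<open>Partial colourings of the complex as binary tries\<close>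

type_synonym key = "bool list"

datatype trie = Empty | Node "colour option" trie trie

fun trie_lookup :: "trie \<Rightarrow> key \<Rightarrow> colour option" where
  "trie_lookup Empty ks = None"
| "trie_lookup (Node x l r) [] = x"
| "trie_lookup (Node x l r) (True # bs) = trie_lookup l bs"
| "trie_lookup (Node x l r) (False # bs) = trie_lookup r bs"

fun trie_update :: "key \<Rightarrow> colour \<Rightarrow> trie \<Rightarrow> trie" where
  "trie_update [] a Empty = Node (Some a) Empty Empty"
| "trie_update [] a (Node x l r) = Node (Some a) l r"
| "trie_update (True # bs) a Empty = Node None (trie_update bs a Empty) Empty"
| "trie_update (False # bs) a Empty = Node None Empty (trie_update bs a Empty)"
| "trie_update (True # bs) a (Node x l r) = Node x (trie_update bs a l) r"
| "trie_update (False # bs) a (Node x l r) = Node x l (trie_update bs a r)"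

fun fits :: "colour option \<Rightarrow> colour \<Rightarrow> bool" where
  "fits None a = True"
| "fits (Some b) a = (a = b)"

fun enter :: "key \<Rightarrow> colour option \<Rightarrow> colour \<Rightarrow> trie \<Rightarrow> trie" where
  "enter k None a \<sigma> = trie_update k a \<sigma>"
| "enter k (Some b) a \<sigma> = \<sigma>"

definition colour_perms :: "(colour \<times> colour \<times> colour) list" where
  "colour_perms = [(Red, Green, Blue), (Red, Blue, Green), (Green, Red, Blue), (Green, Blue, Red), (Blue, Red, Green), (Blue, Green, Red)]"

fun fits3 :: "colour option \<Rightarrow> colour option \<Rightarrow> colour option \<Rightarrow> colour \<times> colour \<times> colour \<Rightarrow> bool" where
  "fits3 o1 o2 o3 (a, b, c) \<longleftrightarrow> fits o1 a \<and> fits o2 b \<and> fits o3 c"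

fun enter3 :: "key \<Rightarrow> key \<Rightarrow> key \<Rightarrow> colour option \<Rightarrow> colour option \<Rightarrow> colour option \<Rightarrow> trie \<Rightarrow> colour \<times> colour \<times> colour \<Rightarrow> trie" where
  "enter3 k1 k2 k3 o1 o2 o3 \<sigma> (a, b, c) = enter k1 o1 a (enter k2 o2 b (enter k3 o3 c \<sigma>))"

text \<open>The looked-up values are arguments so that the filter and the entries share one lookup
  for each key.\<close>

fun extend_by :: "key \<Rightarrow> key \<Rightarrow> key \<Rightarrow> trie \<Rightarrow> colour option \<Rightarrow> colour option \<Rightarrow> colour option \<Rightarrow> trie list" where
  "extend_by k1 k2 k3 \<sigma> o1 o2 o3 = map (enter3 k1 k2 k3 o1 o2 o3 \<sigma>) (filter (fits3 o1 o2 o3) colour_perms)"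

fun extensions :: "key \<times> key \<times> key \<Rightarrow> trie \<Rightarrow> trie list" where
  "extensions (k1, k2, k3) \<sigma> =
     extend_by k1 k2 k3 \<sigma> (trie_lookup \<sigma> k1) (trie_lookup \<sigma> k2) (trie_lookup \<sigma> k3)"

fun search :: "(key \<times> key \<times> key) list \<Rightarrow> trie list \<Rightarrow> trie list" where
  "search [] \<Sigma> = \<Sigma>"
| "search (t # ts) [] = []"
| "search (t # ts) (\<sigma> # \<Sigma>) = search ts (extensions t \<sigma>) @ search (t # ts) \<Sigma>"

text \<open>
  A half-edge lies in a class iff neither of the two steps at its vertex does, so the steps that a class
  contains determine it.
\<close>

fun key :: "words \<Rightarrow> colour \<Rightarrow> key" where
  "key (u, v, w) a = map ((=) a) (u @ v @ w)"

definition keys :: "words \<Rightarrow> key \<times> key \<times> key" where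
  "keys W = (key W Red, key W Green, key W Blue)"

text \<open>A permutation of the values of \<open>f\<close> brings the classes of the first
  colouring to this form, so only one of six equivalent searches is made.\<close>

fun initial :: "key \<times> key \<times> key \<Rightarrow> trie" where
  "initial (k1, k2, k3) = trie_update k1 Red (trie_update k2 Green (trie_update k3 Blue Empty))"

definition complex_solutions :: "words list \<Rightarrow> trie list" where
  "complex_solutions Ws = search (map keys Ws) [initial (keys (hd Ws))]"

type_synonym star_edges = "theta_edge \<times> theta_edge \<times> theta_edge"

definition path_stars :: "theta_path \<Rightarrow> nat \<Rightarrow> star_edges list" where
  "path_stars p n = map (\<lambda>i. (Step p (i - 1), Step p i, Half (Inner p i))) [1..<n]"

definition star_list :: "nat \<Rightarrow> nat \<Rightarrow> nat \<Rightarrow> star_edges list" where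
  "star_list k l m =
     (Step PathU 0, Step PathV 0, Step PathW 0) # (Step PathU (k - 1), Step PathV (l - 1), Step PathW (m - 1)) #
     path_stars PathU k @ path_stars PathV l @ path_stars PathW m"

fun star_colours :: "words \<Rightarrow> star_edges \<Rightarrow> colour \<times> colour \<times> colour" where
  "star_colours W (e1, e2, e3) = (word_colouring W e1, word_colouring W e2, word_colouring W e3)"

fun pick :: "'a \<times> 'a \<times> 'a \<Rightarrow> colour \<Rightarrow> 'a" where
  "pick (x, y, z) Red = x"
| "pick (x, y, z) Green = y"
| "pick (x, y, z) Blue = z"

fun pick3 :: "'a \<times> 'a \<times> 'a \<Rightarrow> colour \<times> colour \<times> colour \<Rightarrow> 'a \<times> 'a \<times> 'a" where
  "pick3 t (a, b, c) = (pick t a, pick t b, pick t c)"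

fun table_values :: "trie \<Rightarrow> key \<times> key \<times> key \<Rightarrow> colour \<times> colour \<times> colour" where
  "table_values \<sigma> (k1, k2, k3) = (the (trie_lookup \<sigma> k1), the (trie_lookup \<sigma> k2), the (trie_lookup \<sigma> k3))"

fun all_same :: "'a list \<Rightarrow> bool" where
  "all_same [] = True"
| "all_same (x # xs) = list_all ((=) x) xs"

type_synonym colours3 = "colour \<times> colour \<times> colour"

definition star_columns :: "words list \<Rightarrow> star_edges list \<Rightarrow> colours3 list list" where
  "star_columns Ws stars = map (\<lambda>s. map (\<lambda>W. star_colours W s) Ws) stars"

text \<open>The colour of an edge is used as an index: \<open>pick3\<close> replaces it by the table
  value of the class of that colour. A star dictates the table iff its column is constant.\<close>

definition value_columns :: "colours3 list list \<Rightarrow> colours3 list \<Rightarrow> colours3 list list" where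
  "value_columns cols vals = map (map2 pick3 vals) cols"

definition dictated_table :: "colours3 list list \<Rightarrow> (key \<times> key \<times> key) list \<Rightarrow> trie \<Rightarrow> bool" where
  "dictated_table cols ks \<sigma> = list_ex all_same (value_columns cols (map (table_values \<sigma>) ks))"

definition all_dictated :: "colours3 list list \<Rightarrow> (key \<times> key \<times> key) list \<Rightarrow> trie list \<Rightarrow> bool" where
  "all_dictated cols ks \<Sigma> = list_all (dictated_table cols ks) \<Sigma>"

definition check_dictatorial :: "words list \<Rightarrow> star_edges list \<Rightarrow> bool" where
  "check_dictatorial Ws stars = all_dictated (star_columns Ws stars) (map keys Ws) (complex_solutions Ws)"

fun distinct3 :: "'a \<times> 'a \<times> 'a \<Rightarrow> bool" where
  "distinct3 (x, y, z) \<longleftrightarrow> x \<noteq> y \<and> x \<noteq> z \<and> y \<noteq> z"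

fun attains :: "colours3 list \<Rightarrow> colour \<Rightarrow> bool" where
  "attains col a = (list_all (\<lambda>(x, y, z). x = a) col \<or> list_all (\<lambda>(x, y, z). y = a) col \<or> list_all (\<lambda>(x, y, z). z = a) col)"

fun pair_free :: "colours3 list list \<Rightarrow> colour \<times> colour \<Rightarrow> bool" where
  "pair_free cols (a, b) = list_all (\<lambda>col. \<not> (attains col a \<and> attains col b)) cols"

text \<open>
  If \<open>\<sigma>\<close> came from a star, its columns would attain every colour. Reflexivity would only give, for any
  two colours, two adjacent edges, hence one column that attains both; \<open>pair_free\<close> excludes this too.
\<close>

definition rogue_table :: "colours3 list list \<Rightarrow> (key \<times> key \<times> key) list \<Rightarrow> trie \<Rightarrow> bool" where
  "rogue_table cols ks \<sigma> \<longleftrightarrow> list_all distinct3 (map (table_values \<sigma>) ks) \<and>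
     list_ex (pair_free (value_columns cols (map (table_values \<sigma>) ks))) [(Red, Green), (Red, Blue), (Green, Blue)]"

definition some_rogue :: "colours3 list list \<Rightarrow> (key \<times> key \<times> key) list \<Rightarrow> trie list \<Rightarrow> bool" where
  "some_rogue cols ks \<Sigma> = list_ex (rogue_table cols ks) \<Sigma>"

definition check_rogue :: "words list \<Rightarrow> star_edges list \<Rightarrow> bool" where
  "check_rogue Ws stars = some_rogue (star_columns Ws stars) (map keys Ws) (complex_solutions Ws)"

definition step_list :: "nat \<Rightarrow> nat \<Rightarrow> nat \<Rightarrow> theta_edge list" where
  "step_list k l m = map (Step PathU) [0..<k] @ map (Step PathV) [0..<l] @ map (Step PathW) [0..<m]"

definition edge_list :: "nat \<Rightarrow> nat \<Rightarrow> nat \<Rightarrow> theta_edge list" where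
  "edge_list k l m = step_list k l m @ map (Half \<circ> Inner PathU) [1..<k] @ map (Half \<circ> Inner PathV) [1..<l] @
     map (Half \<circ> Inner PathW) [1..<m]"

definition check_separated :: "words list \<Rightarrow> theta_edge list \<Rightarrow> bool" where
  "check_separated Ws es = list_all (\<lambda>e. list_all (\<lambda>e'. e = e' \<or> list_ex (\<lambda>W. word_colouring W e \<noteq> word_colouring W e') Ws) es) es"

section \<open>Completeness of the search\<close>

lemma lookup_Cons: "trie_lookup (Node x l r) (b # bs) = trie_lookup (if b then l else r) bs"
  by (cases b) auto

lemma lookup_update [simp]: "trie_lookup (trie_update k a \<sigma>) k' = (if k = k' then Some a else trie_lookup \<sigma> k')"
  by (induction k a \<sigma> arbitrary: k' rule: trie_update.induct) (case_tac k'; auto simp: lookup_Cons)+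

definition agrees :: "trie \<Rightarrow> (key \<Rightarrow> colour) \<Rightarrow> bool" where
  "agrees \<sigma> g \<longleftrightarrow> (\<forall>k a. trie_lookup \<sigma> k = Some a \<longrightarrow> g k = a)"

definition extends :: "trie \<Rightarrow> trie \<Rightarrow> bool" where
  "extends \<sigma>' \<sigma> \<longleftrightarrow> (\<forall>k a. trie_lookup \<sigma> k = Some a \<longrightarrow> trie_lookup \<sigma>' k = Some a)"

fun recorded :: "trie \<Rightarrow> (key \<Rightarrow> colour) \<Rightarrow> key \<times> key \<times> key \<Rightarrow> bool" where
  "recorded \<sigma> g (k1, k2, k3) \<longleftrightarrow> trie_lookup \<sigma> k1 = Some (g k1) \<and> trie_lookup \<sigma> k2 = Some (g k2) \<and> trie_lookup \<sigma> k3 = Some (g k3)"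

fun map3 :: "('a \<Rightarrow> 'b) \<Rightarrow> 'a \<times> 'a \<times> 'a \<Rightarrow> 'b \<times> 'b \<times> 'b" where
  "map3 g (x, y, z) = (g x, g y, g z)"

lemma distinct3_perms: "distinct3 (a, b, c) \<Longrightarrow> (a, b, c) \<in> set colour_perms"
  by (cases a; cases b; cases c) (auto simp: colour_perms_def)

text \<open>All three keys of a triple are looked up in the old table \<open>\<sigma>\<close>, while
  the entries go into successive extensions \<open>\<tau>\<close>. Overwriting is harmless, as every
  entry is a value of the same \<open>g\<close>.\<close>

lemma enter_agrees:
  assumes "agrees \<tau> g" "extends \<tau> \<sigma>" "fits (trie_lookup \<sigma> k) (g k)"
  shows "agrees (enter k (trie_lookup \<sigma> k) (g k) \<tau>) g \<and> extends (enter k (trie_lookup \<sigma> k) (g k) \<tau>) \<tau> \<and>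
    trie_lookup (enter k (trie_lookup \<sigma> k) (g k) \<tau>) k = Some (g k)"
proof (cases "trie_lookup \<sigma> k")
  case None then show ?thesis using assms(1) unfolding agrees_def extends_def by auto
next
  case (Some b) then show ?thesis using assms unfolding agrees_def extends_def by auto
qed

lemma extends_trans: "extends \<rho> \<tau> \<Longrightarrow> extends \<tau> \<sigma> \<Longrightarrow> extends \<rho> \<sigma>"
  unfolding extends_def by blast

lemma extends_recorded: "extends \<tau> \<sigma> \<Longrightarrow> recorded \<sigma> g t \<Longrightarrow> recorded \<tau> g t"
  by (cases t) (auto simp: extends_def)

lemma extensions_sound:
  assumes "agrees \<sigma> g" "distinct3 (map3 g t)"
  shows "\<exists>\<tau>\<in>set (extensions t \<sigma>). agrees \<tau> g \<and> extends \<tau> \<sigma> \<and> recorded \<tau> g t"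
proof (cases t)
  case (fields k1 k2 k3)
  have fits: "fits (trie_lookup \<sigma> k) (g k)" for k
    using assms(1) by (cases "trie_lookup \<sigma> k") (auto simp: agrees_def)
  have "extends \<sigma> \<sigma>" by (simp add: extends_def)
  note e3 = enter_agrees[OF assms(1) this fits, of k3]
  note e2 = enter_agrees[OF conjunct1[OF e3] conjunct1[OF conjunct2[OF e3]] fits, of k2]
  note e1 = enter_agrees[OF conjunct1[OF e2] extends_trans[OF conjunct1[OF conjunct2[OF e2]] conjunct1[OF conjunct2[OF e3]]] fits, of k1]
  let ?\<tau> = "enter3 k1 k2 k3 (trie_lookup \<sigma> k1) (trie_lookup \<sigma> k2) (trie_lookup \<sigma> k3) \<sigma> (g k1, g k2, g k3)"
  have "?\<tau> \<in> set (extensions t \<sigma>)"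
    using distinct3_perms[of "g k1" "g k2" "g k3"] assms(2) fits
    unfolding fields extensions.simps extend_by.simps by (intro image_eqI[of _ _ "(g k1, g k2, g k3)", folded set_map] | simp)+
  moreover have "agrees ?\<tau> g \<and> extends ?\<tau> \<sigma> \<and> recorded ?\<tau> g t"
    using e1 e2 e3 unfolding fields by (auto simp: extends_def)
  ultimately show ?thesis by blast
qed

text \<open>Every colouring of the complex that starts as prescribed is found. That a given table is
  itself a proper colouring is a separate check, made in \<open>rogue_table\<close>.\<close>

lemma search_sound:
  assumes "\<sigma> \<in> set \<Sigma>" "agrees \<sigma> g" "\<forall>t\<in>set ts. distinct3 (map3 g t)"
  shows "\<exists>\<tau>\<in>set (search ts \<Sigma>). agrees \<tau> g \<and> extends \<tau> \<sigma> \<and> (\<forall>t\<in>set ts. recorded \<tau> g t)"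
  using assms
proof (induction ts \<Sigma> arbitrary: \<sigma> rule: search.induct)
  case (1 \<Sigma>)
  then show ?case by (auto simp: extends_def)
next
  case (2 t ts)
  then show ?case by simp
next
  case (3 t ts \<sigma>0 \<Sigma>)
  show ?case
  proof (cases "\<sigma> = \<sigma>0")
    case True
    obtain \<rho> where \<rho>: "\<rho> \<in> set (extensions t \<sigma>0)" "agrees \<rho> g" "extends \<rho> \<sigma>" "recorded \<rho> g t"
      using extensions_sound[OF 3(4), of t] 3(5) True by auto
    obtain \<tau> where \<tau>: "\<tau> \<in> set (search ts (extensions t \<sigma>0))" "agrees \<tau> g" "extends \<tau> \<rho>" "\<forall>t\<in>set ts. recorded \<tau> g t"
      using 3(1)[OF \<rho>(1,2)] 3(5) by auto
    have "\<forall>u\<in>set (t # ts). recorded \<tau> g u" using \<tau>(3,4) extends_recorded[OF \<tau>(3) \<rho>(4)] by simp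
    moreover have "\<tau> \<in> set (search (t # ts) (\<sigma>0 # \<Sigma>))" using \<tau>(1) by simp
    ultimately show ?thesis using \<tau>(2) extends_trans[OF \<tau>(3) \<rho>(3)] by blast
  next
    case False
    then have "\<sigma> \<in> set \<Sigma>" using 3(3) by simp
    from 3(2)[OF this 3(4,5)] show ?thesis by auto
  qed
qed

section \<open>Correctness of the search\<close>

lemma third: "x \<noteq> y \<Longrightarrow> third x y \<noteq> x \<and> third x y \<noteq> y"
  by (cases x; cases y) (auto simp: third_def)

lemma third_unique: "x \<noteq> y \<Longrightarrow> z \<noteq> x \<Longrightarrow> z \<noteq> y \<Longrightarrow> third x y = z"
  by (cases x; cases y; cases z) (auto simp: third_def)

lemma set_walks: "w \<in> set (walks n x) \<longleftrightarrow> length w = Suc n \<and> w ! 0 = x \<and> (\<forall>i<n. w ! i \<noteq> w ! Suc i)"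
proof (induction n arbitrary: x w)
  case 0
  then show ?case by (cases w) auto
next
  case (Suc n)
  have o: "y \<in> set (other_colours x) \<longleftrightarrow> y \<noteq> x" for y by (cases x; cases y) auto
  show ?case
  proof (cases w)
    case (Cons a v)
    have "w \<in> set (walks (Suc n) x) \<longleftrightarrow> a = x \<and> (\<exists>y. y \<noteq> x \<and> v \<in> set (walks n y))"
      unfolding Cons by (simp add: image_iff Bex_def o, blast)
    also have "\<dots> \<longleftrightarrow> a = x \<and> length v = Suc n \<and> v ! 0 \<noteq> x \<and> (\<forall>i<n. v ! i \<noteq> v ! Suc i)"
      unfolding Suc.IH by auto
    also have "\<dots> \<longleftrightarrow> length w = Suc (Suc n) \<and> w ! 0 = x \<and> (\<forall>i<Suc n. w ! i \<noteq> w ! Suc i)"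
      unfolding Cons All_less_Suc2 by auto
    finally show ?thesis .
  qed auto
qed

fun start_colour :: "theta_path \<Rightarrow> colour" where
  "start_colour PathU = Red" | "start_colour PathV = Green" | "start_colour PathW = Blue"

lemma start_colour_inj: "start_colour p = start_colour q \<longleftrightarrow> p = q"
  by (cases p; cases q) auto

context
  fixes k l m :: nat and L Ws
  assumes pos: "k \<ge> 1" "l \<ge> 1" "m \<ge> 1"
  defines "L \<equiv> path_length k l m" and "Ws \<equiv> theta_words k l m"
begin

lemmas positive_lengths = positive_L[OF pos, folded L_def]

lemma length_pos: "0 < L p"
  using positive_lengths unfolding positive_def by blast

lemma theta_words_iff: "W \<in> set Ws \<longleftrightarrow>
  (\<forall>p. length (path_word W p) = L p \<and> path_word W p ! 0 = start_colour p \<and>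
       (\<forall>i. Suc i < L p \<longrightarrow> path_word W p ! i \<noteq> path_word W p ! Suc i)) \<and>
  inj (\<lambda>p. path_word W p ! (L p - 1))"
proof -
  obtain u v w where W: "W = (u, v, w)" by (metis prod_cases3)
  have walk: "path_word W p \<in> set (walks (L p - 1) (start_colour p)) \<longleftrightarrow> length (path_word W p) = L p \<and>
     path_word W p ! 0 = start_colour p \<and> (\<forall>i. Suc i < L p \<longrightarrow> path_word W p ! i \<noteq> path_word W p ! Suc i)" for p
    unfolding set_walks using length_pos[of p] by (auto simp: less_diff_conv)
  have "inj (\<lambda>p. path_word W p ! (L p - 1)) \<longleftrightarrow> sinks_distinct W" if "\<forall>p. length (path_word W p) = L p"
  proof -
    have "path_word W p ! (L p - 1) = last (path_word W p)" for p
    proof -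
      have "path_word W p \<noteq> []" using that length_pos[of p] by (metis length_greater_0_conv)
      then show ?thesis using that by (simp add: last_conv_nth)
    qed
    then have "inj (\<lambda>p. path_word W p ! (L p - 1)) \<longleftrightarrow> inj (\<lambda>p. last (path_word W p))" by simp
    also have "\<dots> \<longleftrightarrow> sinks_distinct W" unfolding inj_def all_theta_path W by auto
    finally show ?thesis .
  qed
  moreover have "W \<in> set Ws \<longleftrightarrow> (\<forall>p. path_word W p \<in> set (walks (L p - 1) (start_colour p))) \<and> sinks_distinct W"
    unfolding Ws_def theta_words_def all_theta_path W L_def by auto
  ultimately show ?thesis unfolding walk by blast
qed

lemma word_colouring_proper:
  assumes "W \<in> set Ws"
  shows "edge_colouring L (word_colouring W)"
  unfolding edge_colouring_def
proof
  note W = assms[unfolded theta_words_iff]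
  fix x assume x: "x \<in> vertices_of L"
  show "inj_on (word_colouring W) (star L x)"
  proof (cases x)
    case Source then show ?thesis using W by (auto simp: inj_on_def start_colour_inj)
  next
    case Sink then show ?thesis using W by (auto simp: inj_on_def dest: injD)
  next
    case (Inner p i)
    then have i: "0 < i" "i < L p" using x by (auto simp: vertices_of_def)
    then have "path_word W p ! (i - 1) \<noteq> path_word W p ! Suc (i - 1)" using W by (metis Suc_pred')
    then have "path_word W p ! (i - 1) \<noteq> path_word W p ! i" using i by simp
    from third[OF this] this show ?thesis unfolding Inner by (auto simp: inj_on_def)
  qed
qed

lemma word_of_colouring:
  assumes d: "edge_colouring L d" and start: "\<And>p. d (Step p 0) = start_colour p"
  shows "\<exists>W\<in>set Ws. \<forall>e\<in>edges_of L. word_colouring W e = d e"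
proof -
  define wd where "wd p = map (\<lambda>i. d (Step p i)) [0..<L p]" for p
  define W where "W = (wd PathU, wd PathV, wd PathW)"
  have pw: "path_word W p = wd p" for p unfolding W_def by (cases p) auto
  have nth: "path_word W p ! i = d (Step p i)" if "i < L p" for p i using that unfolding pw wd_def by simp
  have inner: "inj_on d (star L (Inner p i))" if "0 < i" "i < L p" for p i
    using d that unfolding edge_colouring_def vertices_of_def by blast
  have adj: "d (Step p (i - 1)) \<noteq> d (Step p i)" "d (Half (Inner p i)) \<noteq> d (Step p (i - 1))" "d (Half (Inner p i)) \<noteq> d (Step p i)"
    if "0 < i" "i < L p" for p i
    using inner[OF that] that by (auto simp: inj_on_def)
  have "W \<in> set Ws" unfolding theta_words_iff
  proof (intro conjI allI impI)
    fix p
    show "length (path_word W p) = L p" by (simp add: pw wd_def)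
    show "path_word W p ! 0 = start_colour p" using nth length_pos start by simp
    show "path_word W p ! i \<noteq> path_word W p ! Suc i" if "Suc i < L p" for i
      using adj(1)[of "Suc i" p] that nth by simp
  next
    have "inj_on d (star L Sink)" using d unfolding edge_colouring_def vertices_of_def by blast
    then have "inj (\<lambda>p. d (Step p (L p - 1)))" by (auto simp: inj_on_def inj_def)
    then show "inj (\<lambda>p. path_word W p ! (L p - 1))" using nth length_pos by simp
  qed
  moreover have "word_colouring W e = d e" if "e \<in> edges_of L" for e
    using that
  proof (cases rule: edges_of_cases)
    case (step p i) then show ?thesis using nth by simp
  next
    case (half p i)
    then show ?thesis using nth[of i p] nth[of "i - 1" p] third_unique[OF adj(1) adj(2) adj(3)] by simp
  qed
  ultimately show ?thesis by blast
qed

text \<open>The first steps of the three paths have distinct colours, so a permutation of the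
  colours normalises any colouring. Its classes are those of the word, hence only finitely many
  triples of classes have to be examined.\<close>

lemma colouring_word:
  assumes c: "edge_colouring L c"
  obtains W \<pi> where "W \<in> set Ws" "inj \<pi>" "\<And>e. e \<in> edges_of L \<Longrightarrow> c e = \<pi> (word_colouring W e)"
proof -
  define path where "path a = (case a of Red \<Rightarrow> PathU | Green \<Rightarrow> PathV | Blue \<Rightarrow> PathW)" for a
  have ps: "path (start_colour p) = p" for p by (cases p) (auto simp: path_def)
  have ip: "path a = path b \<longleftrightarrow> a = b" for a b by (cases a; cases b) (auto simp: path_def)
  define \<pi> where "\<pi> a = c (Step (path a) 0)" for a
  have "inj_on c (star L Source)" using c unfolding edge_colouring_def vertices_of_def by blast
  then have \<pi>: "inj \<pi>" by (metis \<pi>_def injI inj_onD ip rangeI star.simps(1) theta_edge.inject(1))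
  have sp: "\<pi> (inv \<pi> b) = b" for b using inj_endo_surj[OF \<pi>] by (simp add: surj_f_inv_f)
  have ii: "inj (inv \<pi>)" by (metis injI sp)
  have "edge_colouring L (inv \<pi> \<circ> c)" 
    using c ii unfolding edge_colouring_def by (auto intro!: comp_inj_on intro: inj_on_subset)
  moreover have "(inv \<pi> \<circ> c) (Step p 0) = start_colour p" for p
    using inv_f_f[OF \<pi>, of "start_colour p"] by (simp add: \<pi>_def ps)
  ultimately obtain W where W: "W \<in> set Ws" "\<forall>e\<in>edges_of L. word_colouring W e = (inv \<pi> \<circ> c) e"
    using word_of_colouring by blast
  then have "c e = \<pi> (word_colouring W e)" if "e \<in> edges_of L" for e using that sp by simp
  with W(1) \<pi> show ?thesis using that by blast
qed

lemma colour_class_word: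
  assumes "inj \<pi>" "\<And>e. e \<in> edges_of L \<Longrightarrow> c e = \<pi> (word_colouring W e)"
  shows "colour_class L c (\<pi> a) = colour_class L (word_colouring W) a"
  using assms unfolding colour_class_def by (auto simp: inj_eq)

definition indicator_of :: "theta_edge set \<Rightarrow> key" where
  "indicator_of C = map (\<lambda>e. e \<in> C) (step_list k l m)"

lemma set_step_list: "set (step_list k l m) = {Step p i | p i. i < L p}"
proof -
  have "Step p i \<in> set (step_list k l m) \<longleftrightarrow> i < L p" for p i
    unfolding step_list_def L_def by (cases p) auto
  moreover have "Half x \<notin> set (step_list k l m)" for x unfolding step_list_def by auto
  ultimately show ?thesis by (auto, metis theta_edge.exhaust)
qed

lemma indicator_word:
  assumes "W \<in> set Ws"
  shows "indicator_of (colour_class L (word_colouring W) a) = key W a"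
proof -
  obtain u v w where W: "W = (u, v, w)" by (metis prod_cases3)
  have "length (path_word W p) = L p" for p using assms theta_words_iff by blast
  from this[of PathU] this[of PathV] this[of PathW] have len: "length u = k" "length v = l" "length w = m"
    unfolding W L_def by auto
  have "map (\<lambda>i. i < length xs \<and> xs ! i = a) [0..<length xs] = map ((=) a) xs" for xs
    by (rule nth_equalityI) auto
  from this[of u] this[of v] this[of w] show ?thesis
    unfolding indicator_of_def step_list_def W colour_class_def edges_of_def L_def len
    by (simp add: comp_def)
qed

lemma indicator_inj: "inj_on indicator_of (colour_classes L)"
proof (rule inj_onI)
  fix C D assume CD: "C \<in> colour_classes L" "D \<in> colour_classes L" "indicator_of C = indicator_of D"
  have steps: "Step p i \<in> C \<longleftrightarrow> Step p i \<in> D" if "i < L p" for p i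
    using CD(3) that unfolding indicator_of_def map_eq_conv set_step_list by blast
  have half: "Half (Inner p i) \<in> E \<longleftrightarrow> Step p (i - 1) \<notin> E \<and> Step p i \<notin> E"
    if E: "E \<in> colour_classes L" and i: "0 < i" "i < L p" for E p i
  proof -
    obtain c a where c: "edge_colouring L c" "E = colour_class L c a" using E unfolding colour_classes_def by blast
    have x: "Inner p i \<in> vertices_of L" using i by (auto simp: vertices_of_def)
    then have inj: "inj_on c (star L (Inner p i))" using c unfolding edge_colouring_def by blast
    have mem: "e \<in> E \<longleftrightarrow> c e = a" if "e \<in> star L (Inner p i)" for e
      using star_subset[OF positive_lengths x] that unfolding c(2) colour_class_def by blast
    have "c (Step p (i - 1)) \<noteq> c (Step p i)" "c (Half (Inner p i)) \<noteq> c (Step p (i - 1))" "c (Half (Inner p i)) \<noteq> c (Step p i)"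
      using inj i by (auto simp: inj_on_def)
    moreover have "Half (Inner p i) \<in> E \<longleftrightarrow> c (Half (Inner p i)) = a" "Step p (i - 1) \<in> E \<longleftrightarrow> c (Step p (i - 1)) = a"
      "Step p i \<in> E \<longleftrightarrow> c (Step p i) = a" by (rule mem, simp)+
    ultimately show ?thesis
      using third_colour[of "c (Step p (i - 1))" "c (Step p i)" "c (Half (Inner p i))" a] by metis
  qed
  have "e \<in> C \<longleftrightarrow> e \<in> D" if "e \<in> edges_of L" for e
    using that
  proof (cases rule: edges_of_cases)
    case h: (half p i)
    then have "i - 1 < L p" by simp
    then show ?thesis using half[OF CD(1) h(2,3)] half[OF CD(2) h(2,3)] steps h(1,3) by blast
  qed (use steps in auto)
  moreover have "C \<subseteq> edges_of L" "D \<subseteq> edges_of L" using CD(1,2) unfolding colour_classes_def colour_class_def by auto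
  ultimately show "C = D" by blast
qed

lemma star_list_complete:
  assumes "x \<in> vertices_of L"
  shows "\<exists>e1 e2 e3. (e1, e2, e3) \<in> set (star_list k l m) \<and> star L x = {e1, e2, e3}"
proof (cases x)
  case Source then show ?thesis unfolding star_list_def
    by (intro exI[of _ "Step PathU 0"] exI[of _ "Step PathV 0"] exI[of _ "Step PathW 0"]) (auto simp: UNIV_theta_path)
next
  case Sink then show ?thesis unfolding star_list_def
    by (intro exI[of _ "Step PathU (k - 1)"] exI[of _ "Step PathV (l - 1)"] exI[of _ "Step PathW (m - 1)"])
      (auto simp: UNIV_theta_path L_def)
next
  case (Inner p i)
  then have "0 < i" "i < L p" using assms by (auto simp: vertices_of_def)
  then have "(Step p (i - 1), Step p i, Half (Inner p i)) \<in> set (star_list k l m)"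
    unfolding star_list_def path_stars_def L_def by (cases p) auto
  then show ?thesis unfolding Inner by auto
qed

lemma star_list_sound:
  assumes "(e1, e2, e3) \<in> set (star_list k l m)"
  shows "\<exists>x\<in>vertices_of L. star L x = {e1, e2, e3}"
proof -
  consider "(e1, e2, e3) = (Step PathU 0, Step PathV 0, Step PathW 0)"
    | "(e1, e2, e3) = (Step PathU (k - 1), Step PathV (l - 1), Step PathW (m - 1))"
    | p where "(e1, e2, e3) \<in> set (path_stars p (L p))"
    using assms unfolding star_list_def L_def by (auto simp del: One_nat_def) (metis path_length.simps)+
  then show ?thesis
  proof cases
    case 1 then show ?thesis by (intro bexI[of _ Source]) (auto simp: UNIV_theta_path vertices_of_def)
  next
    case 2 then show ?thesis by (intro bexI[of _ Sink]) (auto simp: UNIV_theta_path vertices_of_def L_def)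
  next
    case 3
    then obtain i where "0 < i" "i < L p" "e1 = Step p (i - 1)" "e2 = Step p i" "e3 = Half (Inner p i)"
      unfolding path_stars_def by auto
    then show ?thesis by (intro bexI[of _ "Inner p i"]) (auto simp: vertices_of_def)
  qed
qed

lemma separated_if_checked:
  assumes "check_separated Ws (edge_list k l m)"
  shows "separated L"
  unfolding separated_def
proof (intro ballI impI)
  fix e e' assume e: "e \<in> edges_of L" "e' \<in> edges_of L" "e \<noteq> e'"
  have mem: "e \<in> set (edge_list k l m)" if "e \<in> edges_of L" for e
    using that
  proof (cases rule: edges_of_cases)
    case (step p i) then have "e \<in> set (step_list k l m)" unfolding set_step_list by blast
    then show ?thesis unfolding edge_list_def by simp
  next
    case (half p i) then show ?thesis unfolding edge_list_def L_def by (cases p) auto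
  qed
  obtain W where "W \<in> set Ws" "word_colouring W e \<noteq> word_colouring W e'"
    using assms mem[OF e(1)] mem[OF e(2)] e(3) unfolding check_separated_def list_all_iff list_ex_iff by blast
  then show "\<exists>c. edge_colouring L c \<and> c e \<noteq> c e'" using word_colouring_proper by blast
qed

lemma pick3_colours: "pick3 (map3 g (x Red, x Green, x Blue)) t = map3 (\<lambda>a. g (x a)) t"
proof (cases t)
  case (fields a b c)
  have "pick (map3 g (x Red, x Green, x Blue)) d = g (x d)" for d by (cases d) auto
  then show ?thesis unfolding fields by simp
qed

lemma star_colours_map3: "star_colours W t = map3 (word_colouring W) t"
  by (cases t) auto

lemma keys_map3: "keys W = (key W Red, key W Green, key W Blue)"
  by (simp add: keys_def)

text \<open>At word \<open>W\<close> and edge \<open>e\<close>, the column holds the value of the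
  class of \<open>word_colouring W\<close> that contains \<open>e\<close>.\<close>

lemma value_columns_eq:
  assumes "\<And>W. W \<in> set Ws \<Longrightarrow> table_values \<sigma> (keys W) = map3 g (keys W)"
  shows "value_columns (star_columns Ws (star_list k l m)) (map (table_values \<sigma>) (map keys Ws)) =
    map (\<lambda>t. map (\<lambda>W. map3 (\<lambda>e. g (key W (word_colouring W e))) t) Ws) (star_list k l m)"
proof -
  have "pick3 (table_values \<sigma> (keys W)) (star_colours W t) = map3 (\<lambda>e. g (key W (word_colouring W e))) t" if "W \<in> set Ws" for W t
    unfolding assms[OF that] star_colours_map3 unfolding keys_map3 pick3_colours by (cases t) auto
  then show ?thesis
    unfolding value_columns_def star_columns_def by (simp add: map2_map_map comp_def)
qed

lemma class_value:
  assumes "W \<in> set Ws" "inj \<pi>" "\<And>e. e \<in> edges_of L \<Longrightarrow> c e = \<pi> (word_colouring W e)" "e \<in> edges_of L"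
  shows "colour_class L c (c e) = colour_class L (word_colouring W) (word_colouring W e)"
  unfolding assms(3)[OF assms(4)] using colour_class_word[OF assms(2,3)] .

lemma all_same_iff: "all_same xs \<longleftrightarrow> (\<exists>y. \<forall>x\<in>set xs. x = y)"
  by (cases xs) (auto simp: list_all_iff)

lemma dictator_if_checked:
  assumes check: "check_dictatorial Ws (star_list k l m)" and ne: "Ws \<noteq> []"
    and f: "complex_colouring L f"
    and norm: "\<And>a. f (colour_class L (word_colouring (hd Ws)) a) = a"
  shows "\<exists>s. star_enum L s \<and> (\<forall>c. edge_colouring L c \<longrightarrow> dictates L f s c)"
proof -
  \<comment> \<open>Classes are determined by their keys, so \<open>f\<close> can be read as a
    function of keys and compared with the search.\<close>
  define g where "g K = f (inv_into (colour_classes L) indicator_of K)" for K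
  have g: "g (key W a) = f (colour_class L (word_colouring W) a)" if "W \<in> set Ws" for W a
  proof -
    have "colour_class L (word_colouring W) a \<in> colour_classes L"
      using word_colouring_proper[OF that] unfolding colour_classes_def by blast
    then show ?thesis unfolding g_def indicator_word[OF that, symmetric] by (simp add: inv_into_f_f indicator_inj)
  qed
  have fin: "inj (\<lambda>a. f (colour_class L (word_colouring W) a))" if "W \<in> set Ws" for W
    using f word_colouring_proper[OF that] unfolding complex_colouring_def by blast
  have hd: "hd Ws \<in> set Ws" using ne by simp
  have gd: "\<forall>t\<in>set (map keys Ws). distinct3 (map3 g t)"
  proof
    fix t assume "t \<in> set (map keys Ws)"
    then obtain W where W: "W \<in> set Ws" "t = keys W" by auto
    then show "distinct3 (map3 g t)" unfolding keys_map3 by (simp add: g[OF W(1)] inj_eq[OF fin[OF W(1)]])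
  qed
  have "agrees (initial (keys (hd Ws))) g"
  proof -
    have gn: "g (key (hd Ws) a) = a" for a using g[OF hd] norm by simp
    then have "key (hd Ws) a = key (hd Ws) b \<longleftrightarrow> a = b" for a b by metis
    with gn show ?thesis unfolding keys_map3 agrees_def by auto
  qed
  then obtain \<sigma> where \<sigma>: "\<sigma> \<in> set (complex_solutions Ws)" "\<forall>t\<in>set (map keys Ws). recorded \<sigma> g t"
    using search_sound[of "initial (keys (hd Ws))" "[initial (keys (hd Ws))]" g "map keys Ws"] gd
    unfolding complex_solutions_def by auto
  have tv: "table_values \<sigma> (keys W) = map3 g (keys W)" if "W \<in> set Ws" for W
    using \<sigma>(2) that unfolding keys_map3 by (auto simp: keys_map3)
  have columns: "value_columns (star_columns Ws (star_list k l m)) (map (table_values \<sigma>) (map keys Ws)) =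
    map (\<lambda>t. map (\<lambda>W. map3 (\<lambda>e. g (key W (word_colouring W e))) t) Ws) (star_list k l m)"
    by (rule value_columns_eq) (rule tv)
  have "dictated_table (star_columns Ws (star_list k l m)) (map keys Ws) \<sigma>"
    using check \<sigma>(1) unfolding check_dictatorial_def all_dictated_def list_all_iff by blast
  then obtain t where t: "t \<in> set (star_list k l m)"
    and "all_same (map (\<lambda>W. map3 (\<lambda>e. g (key W (word_colouring W e))) t) Ws)"
    unfolding dictated_table_def columns list_ex_iff set_map by blast
  then obtain y where y: "\<And>W. W \<in> set Ws \<Longrightarrow> map3 (\<lambda>e. f (colour_class L (word_colouring W) (word_colouring W e))) t = y"
    unfolding all_same_iff by (cases t) (auto simp: g)
  obtain e1 e2 e3 where te: "t = (e1, e2, e3)" by (metis prod_cases3)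
  obtain a b d where yd: "y = (a, b, d)" by (metis prod_cases3)
  obtain x where x: "x \<in> vertices_of L" "star L x = {e1, e2, e3}" using star_list_sound t te by blast
  have edges: "e1 \<in> edges_of L" "e2 \<in> edges_of L" "e3 \<in> edges_of L"
    using star_subset[OF positive_lengths x(1)] x(2) by auto
  have val: "f (colour_class L c (c e1)) = a" "f (colour_class L c (c e2)) = b" "f (colour_class L c (c e3)) = d"
    if c: "edge_colouring L c" for c
  proof -
    obtain W \<pi> where W: "W \<in> set Ws" "inj \<pi>" "\<And>e. e \<in> edges_of L \<Longrightarrow> c e = \<pi> (word_colouring W e)"
      using colouring_word[OF c] by blast
    show "f (colour_class L c (c e1)) = a" "f (colour_class L c (c e2)) = b" "f (colour_class L c (c e3)) = d"
      using y[OF W(1)] class_value[OF W] edges unfolding te yd by auto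
  qed
  have dis: "e1 \<noteq> e2" "e1 \<noteq> e3" "e2 \<noteq> e3" using card_star[OF x(1)] unfolding x(2) by (auto simp: card_insert_if split: if_splits)
  let ?c = "word_colouring (hd Ws)"
  have c: "edge_colouring L ?c" using word_colouring_proper[OF hd] .
  have "inj_on ?c {e1, e2, e3}" using c x unfolding edge_colouring_def by metis
  then have "?c e1 \<noteq> ?c e2" "?c e1 \<noteq> ?c e3" "?c e2 \<noteq> ?c e3" using dis by (auto simp: inj_on_def)
  then have abd: "a \<noteq> b" "a \<noteq> d" "b \<noteq> d" using val[OF c] norm by auto
  \<comment> \<open>The constant column lists the values belonging to the three edges;
    \<open>s\<close> inverts this list.\<close>
  define s where "s z = (if z = a then e1 else if z = b then e2 else e3)" for z
  have s: "s a = e1" "s b = e2" "s d = e3" using abd by (auto simp: s_def)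
  have U: "z = a \<or> z = b \<or> z = d" for z using third_colour[OF abd, of z] by blast
  have "inj s" unfolding inj_def using dis U s by metis
  moreover have "range s \<subseteq> {e1, e2, e3}" unfolding s_def by auto
  moreover have "{e1, e2, e3} \<subseteq> range s" using s by (metis empty_subsetI insert_subset rangeI)
  ultimately have "bij_betw s UNIV (star L x)" unfolding bij_betw_def x(2) by blast
  then have "star_enum L s" using x(1) unfolding star_enum_def by blast
  moreover have "dictates L f s c" if "edge_colouring L c" for c
    unfolding dictates_def using U val[OF that] s by metis
  ultimately show ?thesis by blast
qed

text \<open>The values of \<open>f\<close> are permuted so that the first word receives the
  prescribed ones, and the star found is indexed back by the inverse permutation.\<close>

lemma dictatorial_if_checked:
  assumes "check_dictatorial Ws (star_list k l m)" "Ws \<noteq> []"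
  shows "dictatorial L"
  unfolding dictatorial_def
proof (intro allI impI)
  fix f assume f: "complex_colouring L f"
  let ?c = "word_colouring (hd Ws)"
  define \<pi> where "\<pi> a = f (colour_class L ?c a)" for a
  have "edge_colouring L ?c" using word_colouring_proper assms(2) by simp
  then have \<pi>: "inj \<pi>" using f unfolding complex_colouring_def \<pi>_def by blast
  have sp: "\<pi> (inv \<pi> b) = b" for b using inj_endo_surj[OF \<pi>] by (simp add: surj_f_inv_f)
  have ii: "inj (inv \<pi>)" by (metis injI sp)
  have "complex_colouring L (inv \<pi> \<circ> f)"
    unfolding complex_colouring_def
  proof (intro allI impI)
    fix c assume "edge_colouring L c"
    then have "inj (\<lambda>a. f (colour_class L c a))" using f unfolding complex_colouring_def by blast
    from inj_compose[OF ii this] show "inj (\<lambda>a. (inv \<pi> \<circ> f) (colour_class L c a))" by (simp add: comp_def)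
  qed
  moreover have "(inv \<pi> \<circ> f) (colour_class L ?c a) = a" for a
    using inv_f_f[OF \<pi>, of a] by (simp add: \<pi>_def)
  ultimately obtain s where s: "star_enum L s" "\<And>c. edge_colouring L c \<Longrightarrow> dictates L (inv \<pi> \<circ> f) s c"
    using dictator_if_checked[OF assms] by blast
  have bij: "bij (inv \<pi>)" using ii inj_endo_surj[OF ii] by (simp add: bij_def)
  have "star_enum L (s \<circ> inv \<pi>)" using s(1) bij_betw_trans[OF bij] unfolding star_enum_def by blast
  moreover have "dictates L f (s \<circ> inv \<pi>) c" if "edge_colouring L c" for c
    unfolding dictates_def
  proof
    fix a
    have "inv \<pi> (f (colour_class L c (c (s (inv \<pi> a))))) = inv \<pi> a"
      using s(2)[OF that] unfolding dictates_def by simp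
    then show "f (colour_class L c (c ((s \<circ> inv \<pi>) a))) = a" using ii by (simp add: inj_eq)
  qed
  ultimately show "\<exists>s. star_enum L s \<and> (\<forall>c. edge_colouring L c \<longrightarrow> dictates L f s c)" by blast
qed

lemma not_edge_reflexive_if_rogue:
  assumes "check_rogue Ws (star_list k l m)"
  shows "\<not> edge_reflexive (cubic_theta k l m)"
proof
  assume refl: "edge_reflexive (cubic_theta k l m)"
  let ?cols = "star_columns Ws (star_list k l m)"
  obtain \<sigma> where \<sigma>: "list_all distinct3 (map (table_values \<sigma>) (map keys Ws))"
    "list_ex (pair_free (value_columns ?cols (map (table_values \<sigma>) (map keys Ws)))) [(Red, Green), (Red, Blue), (Green, Blue)]"
    using assms unfolding check_rogue_def some_rogue_def rogue_table_def list_ex_iff by blast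
  \<comment> \<open>An unrecorded key gives an unspecified value; only keys of words matter, and for
    these \<open>distinct3\<close> has been checked.\<close>
  define g where "g K = the (trie_lookup \<sigma> K)" for K
  define f where "f C = g (indicator_of C)" for C
  have tv: "table_values \<sigma> (keys W) = map3 g (keys W)" for W unfolding keys_map3 g_def by simp
  have fc: "f (colour_class L (word_colouring W) a) = g (key W a)" if "W \<in> set Ws" for W a
    unfolding f_def indicator_word[OF that] ..
  have f: "complex_colouring L f"
    unfolding complex_colouring_def
  proof (intro allI impI)
    fix c assume "edge_colouring L c"
    then obtain W \<pi> where W: "W \<in> set Ws" "inj \<pi>" "\<And>e. e \<in> edges_of L \<Longrightarrow> c e = \<pi> (word_colouring W e)"
      using colouring_word by blast
    have "distinct3 (map3 g (keys W))" using \<sigma>(1) W(1) unfolding list_all_iff by (auto simp: tv)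
    then have "inj (\<lambda>a. g (key W a))" unfolding keys_map3 inj_def all_colour by auto
    moreover have "f (colour_class L c (\<pi> a)) = g (key W a)" for a
      using colour_class_word[OF W(2,3)] fc[OF W(1)] by simp
    ultimately have i: "inj (\<lambda>a. f (colour_class L c (\<pi> a)))" by simp
    show "inj (\<lambda>a. f (colour_class L c a))"
    proof (rule injI)
      fix a b assume "f (colour_class L c a) = f (colour_class L c b)"
      moreover obtain a' b' where "a = \<pi> a'" "b = \<pi> b'" using inj_endo_surj[OF W(2)] by (metis surjD)
      ultimately show "a = b" using i by (auto dest: injD)
    qed
  qed
  obtain a b where ab: "a \<noteq> b" "pair_free (value_columns ?cols (map (table_values \<sigma>) (map keys Ws))) (a, b)"
    using \<sigma>(2) by auto
  from edge_reflexive_imp(2)[OF pos refl f[unfolded L_def] ab(1), folded L_def]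
  obtain x e e' where x: "x \<in> vertices_of L" "e \<in> star L x" "e' \<in> star L x"
    and val: "\<And>c. edge_colouring L c \<Longrightarrow> f (colour_class L c (c e)) = a \<and> f (colour_class L c (c e')) = b" by blast
  obtain e1 e2 e3 where t: "(e1, e2, e3) \<in> set (star_list k l m)" "star L x = {e1, e2, e3}"
    using star_list_complete[OF x(1)] by blast
  let ?col = "map (\<lambda>W. map3 (\<lambda>e. g (key W (word_colouring W e))) (e1, e2, e3)) Ws"
  have v: "g (key W (word_colouring W e)) = a" "g (key W (word_colouring W e')) = b" if "W \<in> set Ws" for W
    using val[OF word_colouring_proper[OF that]] fc[OF that] by auto
  have "attains ?col a" using v(1) x(2) unfolding t(2) by (auto simp: list_all_iff)
  moreover have "attains ?col b" using v(2) x(3) unfolding t(2) by (auto simp: list_all_iff)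
  moreover have "\<not> (attains ?col a \<and> attains ?col b)"
    using ab(2) t(1) unfolding value_columns_eq[OF tv] pair_free.simps list_all_iff by auto
  ultimately show False by blast
qed

end

section \<open>Classification\<close>

lemma path_length_update [simp]:
  "(path_length k l m)(PathU := n) = path_length n l m"
  "(path_length k l m)(PathV := n) = path_length k n m"
  "(path_length k l m)(PathW := n) = path_length k l n"
  unfolding fun_eq_iff all_theta_path by auto

lemma positive_path_length: "positive (path_length k l m) \<longleftrightarrow> 0 < k \<and> 0 < l \<and> 0 < m"
  unfolding positive_def all_theta_path by simp

lemma colouring_if_separated:
  assumes "positive L" "separated L"
  shows "\<exists>c. edge_colouring L c"
proof -
  have "Step PathU 0 \<in> edges_of L" "Step PathV 0 \<in> edges_of L"
    using assms(1) unfolding edges_of_def positive_def by auto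
  then show ?thesis using assms(2) unfolding separated_def by blast
qed

lemma separated_raise:
  assumes "positive L" "separated L" "3 \<le> L p" "L p \<le> n"
  shows "separated (L(p := n))"
  using assms(4)
proof (induction n rule: dec_induct)
  case base then show ?case using assms(2) by simp
next
  case (step n)
  have "positive (L(p := n))" "3 \<le> (L(p := n)) p" using assms(1,3) step(1) unfolding positive_def by simp_all
  from separated_step[OF this step.IH] show ?case by (simp only: fun_upd_same fun_upd_upd)
qed

lemma path_length_swaps:
  "path_length l k m = path_length k l m \<circ> (id(PathU := PathV, PathV := PathU))"
  "path_length k m l = path_length k l m \<circ> (id(PathV := PathW, PathW := PathV))"
  unfolding fun_eq_iff all_theta_path by auto

lemma bij_swaps:
  "bij (id(PathU := PathV, PathV := PathU))" "bij (id(PathV := PathW, PathW := PathV))"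
  by (rule involuntory_imp_bij, simp add: all_theta_path)+

lemma swap_iff:
  assumes "0 < k" "0 < l" "0 < m"
  shows "separated (path_length l k m) \<longleftrightarrow> separated (path_length k l m)"
    "separated (path_length k m l) \<longleftrightarrow> separated (path_length k l m)"
    "dictatorial (path_length l k m) \<longleftrightarrow> dictatorial (path_length k l m)"
    "dictatorial (path_length k m l) \<longleftrightarrow> dictatorial (path_length k l m)"
proof -
  have s: "separated (path_length l k m)" "separated (path_length k m l)" if "separated (path_length k l m)" "0 < k" "0 < l" "0 < m" for k l m
    using separated_permute[OF _ bij_swaps(1) that(1)] separated_permute[OF _ bij_swaps(2) that(1)] that(2-)
    unfolding path_length_swaps(1)[of l k m] path_length_swaps(2)[of k m l] positive_path_length by blast+
  have d: "dictatorial (path_length l k m)" "dictatorial (path_length k m l)" if "dictatorial (path_length k l m)" "0 < k" "0 < l" "0 < m" for k l m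
    using dictatorial_permute[OF _ bij_swaps(1) that(1)] dictatorial_permute[OF _ bij_swaps(2) that(1)] that(2-)
    unfolding path_length_swaps(1)[of l k m] path_length_swaps(2)[of k m l] positive_path_length by blast+
  show "separated (path_length l k m) \<longleftrightarrow> separated (path_length k l m)"
    "separated (path_length k m l) \<longleftrightarrow> separated (path_length k l m)"
    "dictatorial (path_length l k m) \<longleftrightarrow> dictatorial (path_length k l m)"
    "dictatorial (path_length k m l) \<longleftrightarrow> dictatorial (path_length k l m)"
    using s d assms by blast+
qed

text \<open>Apart from the isolated (1, 1, 1), these are the starting points for raising path
  lengths from three on.\<close>

lemma separated_bases:
  "separated (path_length 1 1 1)" "separated (path_length 1 3 3)" "separated (path_length 2 2 3)"
  "separated (path_length 2 3 3)" "separated (path_length 3 3 3)"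
proof -
  have "\<forall>(k, l, m)\<in>set [(1, 1, 1), (1, 3, 3), (2, 2, 3), (2, 3, 3), (3, 3, 3)].
    1 \<le> k \<and> 1 \<le> l \<and> 1 \<le> m \<and> check_separated (theta_words k l m) (edge_list k l m)"
    by code_simp
  then show "separated (path_length 1 1 1)" "separated (path_length 1 3 3)" "separated (path_length 2 2 3)"
    "separated (path_length 2 3 3)" "separated (path_length 3 3 3)"
    by (simp_all add: separated_if_checked)
qed

text \<open>The triples where the induction cannot start lower. In (1, 1, 1) no path can be
  shortened. For the others with a path of length one, shortening a path of length at most five by
  three leaves no separated graph. From (2, 2, 5), (2, 3, 5), (2, 4, 4) and (3, 3, 4), the only
  possible shortening by one leads to an exception.\<close>

definition dictatorial_triples :: "(nat \<times> nat \<times> nat) list" where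
  "dictatorial_triples = [(1, 1, 1), (1, 3, 3), (1, 3, 4), (1, 3, 5), (1, 4, 4), (1, 4, 5), (1, 5, 5),
     (2, 2, 5), (2, 3, 5), (2, 4, 4), (3, 3, 4)]"

lemma dictatorial_triples_checked:
  "\<forall>(k, l, m)\<in>set dictatorial_triples. 1 \<le> k \<and> 1 \<le> l \<and> 1 \<le> m \<and> theta_words k l m \<noteq> [] \<and>
     check_dictatorial (theta_words k l m) (star_list k l m)"
  by code_simp

lemma dictatorial_bases:
  assumes "(k, l, m) \<in> set dictatorial_triples"
  shows "dictatorial (path_length k l m)"
proof -
  have "1 \<le> k" "1 \<le> l" "1 \<le> m" "theta_words k l m \<noteq> []"
    "check_dictatorial (theta_words k l m) (star_list k l m)"
    using bspec[OF dictatorial_triples_checked assms] by auto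
  then show ?thesis using dictatorial_if_checked by blast
qed

text \<open>All orders of the six sporadic triples occur, because invariance under permutations is
  established for \<open>separated\<close> and \<open>dictatorial\<close>, whereas the rogue check
  concerns a graph with its paths in a fixed order.\<close>

definition rogue_triples :: "(nat \<times> nat \<times> nat) list" where
  "rogue_triples = [(2, 2, 2), (2, 2, 3), (2, 3, 2), (3, 2, 2), (2, 2, 4), (2, 4, 2), (4, 2, 2),
     (2, 3, 3), (3, 2, 3), (3, 3, 2), (2, 3, 4), (2, 4, 3), (3, 2, 4), (3, 4, 2), (4, 2, 3), (4, 3, 2), (3, 3, 3)]"

lemma rogue_triples_checked:
  "\<forall>(k, l, m)\<in>set rogue_triples. check_rogue (theta_words k l m) (star_list k l m)"
  by code_simp

lemma separated_one: "3 \<le> l \<Longrightarrow> 3 \<le> m \<Longrightarrow> separated (path_length 1 l m)"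
  using separated_raise[of "path_length 1 3 3" PathV l] separated_raise[of "path_length 1 l 3" PathW m] separated_bases
  by (simp add: positive_path_length)

lemma separated_two_two: "3 \<le> m \<Longrightarrow> separated (path_length 2 2 m)"
  using separated_raise[of "path_length 2 2 3" PathW m] separated_bases
  by (simp add: positive_path_length)

lemma separated_two: "3 \<le> l \<Longrightarrow> 3 \<le> m \<Longrightarrow> separated (path_length 2 l m)"
  using separated_raise[of "path_length 2 3 3" PathV l] separated_raise[of "path_length 2 l 3" PathW m] separated_bases
  by (simp add: positive_path_length)

lemma separated_three: "3 \<le> k \<Longrightarrow> 3 \<le> l \<Longrightarrow> 3 \<le> m \<Longrightarrow> separated (path_length k l m)"
  using separated_raise[of "path_length 3 3 3" PathU k] separated_raise[of "path_length k 3 3" PathV l]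
    separated_raise[of "path_length k l 3" PathW m] separated_bases
  by (simp add: positive_path_length)

lemma dictatorial_last:
  assumes "0 < k" "2 \<le> l" "4 \<le> m" "dictatorial (path_length k l (m - 1))"
    "separated (path_length k l (m - 3))" "separated (path_length k l (m - 2))"
  shows "dictatorial (path_length k l m)"
proof -
  have "positive (path_length k l (m - 2))" "positive (path_length k l (m - 1))"
    using assms(1-3) by (auto simp: positive_path_length)
  moreover have "m - 1 - 2 = m - 3" "m - 1 - 1 = m - 2" "Suc (m - 1) = m" using assms(3) by auto
  moreover have "\<exists>q. q \<noteq> PathW \<and> 1 < path_length k l (m - 1) q" using assms(2) by (intro exI[of _ PathV]) auto
  ultimately show ?thesis
    using dictatorial_step[of "path_length k l (m - 1)" PathW] colouring_if_separated assms(3-6) by simp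
qed

text \<open>The longer of the two paths is shortened. From length six on, it keeps length at least
  three after losing three steps, as separation beside a path of length one requires.\<close>

lemma dictatorial_one: "3 \<le> l \<Longrightarrow> 3 \<le> m \<Longrightarrow> dictatorial (path_length 1 l m)"
proof (induction "l + m" arbitrary: l m rule: less_induct)
  case less
  have "dictatorial (path_length 1 l m)" if "3 \<le> l" "l \<le> m" and IH: "\<And>a b. a + b < l + m \<Longrightarrow> 3 \<le> a \<Longrightarrow> 3 \<le> b \<Longrightarrow> dictatorial (path_length 1 a b)" for l m
  proof (cases "m \<le> 5")
    case True
    then have "(1, l, m) \<in> set dictatorial_triples" using that by (auto simp: dictatorial_triples_def)
    then show ?thesis by (rule dictatorial_bases)
  next
    case False
    then show ?thesis using that by (intro dictatorial_last[OF _ _ _ IH separated_one separated_one]) auto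
  qed
  from this[of l m] this[of m l] show ?case
    using less swap_iff(4)[of 1 l m] by (cases "l \<le> m") (auto simp: add.commute)
qed

lemma dictatorial_two:
  "2 \<le> l \<Longrightarrow> 2 \<le> m \<Longrightarrow> 5 \<le> l \<or> 5 \<le> m \<or> l = 4 \<and> m = 4 \<Longrightarrow> dictatorial (path_length 2 l m)"
proof (induction "l + m" arbitrary: l m rule: less_induct)
  case less
  have "dictatorial (path_length 2 l m)" if lm: "2 \<le> l" "l \<le> m" "5 \<le> m \<or> l = 4 \<and> m = 4"
    and IH: "\<And>a b. a + b < l + m \<Longrightarrow> 2 \<le> a \<Longrightarrow> 2 \<le> b \<Longrightarrow> 5 \<le> a \<or> 5 \<le> b \<or> a = 4 \<and> b = 4 \<Longrightarrow> dictatorial (path_length 2 a b)" for l m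
  proof -
    consider "(2, l, m) \<in> set dictatorial_triples" | "m = 5" "4 \<le> l" | "6 \<le> m"
      using lm unfolding dictatorial_triples_def by fastforce
    then show ?thesis
    proof cases
      case 1 then show ?thesis by (rule dictatorial_bases)
    next
      case 2
      \<comment> \<open>Here m - 3 = 2, so the triple falls under the case of two paths of length
        two.\<close>
      have "separated (path_length 2 l 2)" using swap_iff(2)[of 2 2 l] separated_two_two[of l] 2 by simp
      then show ?thesis using 2 lm swap_iff(2)[of 2 l 2]
        by (intro dictatorial_last[OF _ _ _ IH _ separated_two]) auto
    next
      case 3
      have "separated (path_length 2 l n)" if "3 \<le> n" for n
        using separated_two_two[OF that] separated_two[OF _ that, of l] lm(1) by (cases "l = 2") auto
      then show ?thesis using 3 lm by (intro dictatorial_last[OF _ _ _ IH]) auto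
    qed
  qed
  from this[of l m] this[of m l] show ?case
    using less swap_iff(4)[of 2 l m] by (cases "l \<le> m") (auto simp: add.commute)
qed

lemma sorted_triple_wlog:
  fixes P :: "nat \<Rightarrow> nat \<Rightarrow> nat \<Rightarrow> bool"
  assumes swap: "\<And>k l m. P k l m \<Longrightarrow> P l k m" "\<And>k l m. P k l m \<Longrightarrow> P k m l"
    and sorted: "\<And>k l m. k \<le> l \<Longrightarrow> l \<le> m \<Longrightarrow> P k l m"
  shows "P k l m"
proof -
  consider "k \<le> l" "l \<le> m" | "k \<le> m" "m \<le> l" | "l \<le> k" "k \<le> m" | "l \<le> m" "m \<le> k" | "m \<le> k" "k \<le> l" | "m \<le> l" "l \<le> k"
    by linarith
  then show ?thesis by cases (use swap sorted in blast)+
qed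

lemma dictatorial_three:
  "3 \<le> k \<Longrightarrow> 3 \<le> l \<Longrightarrow> 3 \<le> m \<Longrightarrow> 4 \<le> k \<or> 4 \<le> l \<or> 4 \<le> m \<Longrightarrow> dictatorial (path_length k l m)"
proof (induction "k + l + m" arbitrary: k l m rule: less_induct)
  case less
  \<comment> \<open>The induction hypothesis is symmetric in the three lengths; carrying it inside
    \<open>?P\<close> lets it survive the reduction to sorted triples.\<close>
  let ?P = "\<lambda>k l m. 3 \<le> k \<and> 3 \<le> l \<and> 3 \<le> m \<and> (4 \<le> k \<or> 4 \<le> l \<or> 4 \<le> m) \<and>
    (\<forall>a b c. a + b + c < k + l + m \<longrightarrow> 3 \<le> a \<longrightarrow> 3 \<le> b \<longrightarrow> 3 \<le> c \<longrightarrow> 4 \<le> a \<or> 4 \<le> b \<or> 4 \<le> c \<longrightarrow> dictatorial (path_length a b c))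
    \<longrightarrow> dictatorial (path_length k l m)"
  have "?P k l m"
  proof (rule sorted_triple_wlog[of ?P])
    show "?P l k m" if "?P k l m" for k l m using that swap_iff(3)[of k l m] by (auto simp: ac_simps)
    show "?P k m l" if "?P k l m" for k l m using that swap_iff(4)[of k l m] by (auto simp: ac_simps)
    show "?P k l m" if klm: "k \<le> l" "l \<le> m" for k l m
    proof (intro impI; elim conjE)
      assume ge: "3 \<le> k" "3 \<le> l" "3 \<le> m" "4 \<le> k \<or> 4 \<le> l \<or> 4 \<le> m"
        and IH: "\<forall>a b c. a + b + c < k + l + m \<longrightarrow> 3 \<le> a \<longrightarrow> 3 \<le> b \<longrightarrow> 3 \<le> c \<longrightarrow> 4 \<le> a \<or> 4 \<le> b \<or> 4 \<le> c \<longrightarrow> dictatorial (path_length a b c)"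
      have two: "separated (path_length k l 2)"
        using swap_iff(1,2)[of k 2 l] swap_iff(1)[of 2 k l] separated_two[of k l] ge by simp
      consider "k = 3" "l = 3" "m = 4" | "l = 4" "m = 4" | "5 \<le> m" using klm ge by linarith
      then show "dictatorial (path_length k l m)"
      proof cases
        case 1
        then have "(k, l, m) \<in> set dictatorial_triples" by (simp add: dictatorial_triples_def)
        then show ?thesis by (rule dictatorial_bases)
      next
        case 2
        have "separated (path_length k l 1)"
          using swap_iff(2)[of k 1 l] swap_iff(1)[of 1 k l] separated_one[of k l] ge by simp
        then show ?thesis using 2 ge two by (intro dictatorial_last[OF _ _ _ IH[rule_format]]) auto
      next
        case 3
        have "separated (path_length k l n)" if "2 \<le> n" for n
          using two separated_three[of k l n] that ge by (cases "n = 2") auto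
        then show ?thesis using 3 ge by (intro dictatorial_last[OF _ _ _ IH[rule_format]]) auto
      qed
    qed
  qed
  then show ?case using less by blast
qed

text \<open>The two parallel edges use up the same two colours at both branch vertices, so the first
  and last step of the third path always agree.\<close>

lemma not_separated_one_one:
  assumes "2 \<le> m"
  shows "\<not> separated (path_length 1 1 m)"
proof
  let ?L = "path_length 1 1 m"
  assume sep: "separated ?L"
  have "Step PathW 0 \<in> edges_of ?L" "Step PathW (m - 1) \<in> edges_of ?L" "Step PathW 0 \<noteq> Step PathW (m - 1)"
    using assms by (auto simp: edges_of_def)
  then obtain c where c: "edge_colouring ?L c" "c (Step PathW 0) \<noteq> c (Step PathW (m - 1))"
    using sep unfolding separated_def by blast
  have "inj_on c (star ?L Source)" "inj_on c (star ?L Sink)"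
    using c(1) unfolding edge_colouring_def vertices_of_def by blast+
  then have "c (Step PathU 0) \<noteq> c (Step PathV 0)" "c (Step PathW 0) \<noteq> c (Step PathU 0)" "c (Step PathW 0) \<noteq> c (Step PathV 0)"
    "c (Step PathW (m - 1)) \<noteq> c (Step PathU 0)" "c (Step PathW (m - 1)) \<noteq> c (Step PathV 0)"
    by (auto simp: UNIV_theta_path)
  then show False using c(2)
      third_colour[of "c (Step PathU 0)" "c (Step PathV 0)" "c (Step PathW 0)" "c (Step PathW (m - 1))"] by metis
qed

text \<open>The paths of lengths one and two form a triangle with three colours; the half-edge at
  its inner vertex repeats the colour of the opposite edge.\<close>

lemma not_separated_one_two:
  assumes "1 \<le> m"
  shows "\<not> separated (path_length 1 2 m)"
proof
  let ?L = "path_length 1 2 m"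
  assume sep: "separated ?L"
  have "Step PathU 0 \<in> edges_of ?L" "Half (Inner PathV 1) \<in> edges_of ?L"
    by (auto simp: edges_of_def)
  then obtain c where c: "edge_colouring ?L c" "c (Step PathU 0) \<noteq> c (Half (Inner PathV 1))"
    using sep unfolding separated_def by blast
  have "Inner PathV 1 \<in> vertices_of ?L" by (simp add: vertices_of_def)
  then have "inj_on c (star ?L Source)" "inj_on c (star ?L Sink)" "inj_on c (star ?L (Inner PathV 1))"
    using c(1) unfolding edge_colouring_def vertices_of_def by blast+
  then have "c (Step PathU 0) \<noteq> c (Step PathV 0)" "c (Step PathU 0) \<noteq> c (Step PathV 1)" "c (Step PathV 0) \<noteq> c (Step PathV 1)"
    "c (Half (Inner PathV 1)) \<noteq> c (Step PathV 0)" "c (Half (Inner PathV 1)) \<noteq> c (Step PathV 1)"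
    by (auto simp: UNIV_theta_path)
  then show False using c(2)
      third_colour[of "c (Step PathV 0)" "c (Step PathV 1)" "c (Step PathU 0)" "c (Half (Inner PathV 1))"] by metis
qed

lemma sorted_triple_mset_eq:
  fixes a b c k l m :: nat
  assumes "k \<le> l" "l \<le> m" "a \<le> b" "b \<le> c"
  shows "{#k, l, m#} = {#a, b, c#} \<longleftrightarrow> k = a \<and> l = b \<and> m = c"
proof
  assume "{#k, l, m#} = {#a, b, c#}"
  then have "mset [k, l, m] = mset [a, b, c]" by simp
  then have "sort [k, l, m] = sort [a, b, c]" by (metis sorted_list_of_multiset_mset)
  moreover have "sort [k, l, m] = [k, l, m]" "sort [a, b, c] = [a, b, c]"
    using assms by (auto intro: sorted_sort_id)
  ultimately show "k = a \<and> l = b \<and> m = c" by simp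
qed auto

lemma listed_sorted_iff:
  assumes "k \<le> l" "l \<le> m"
  shows "{#k, l, m#} \<in> listed_parameters \<longleftrightarrow> k = 1 \<and> l = 1 \<and> 2 \<le> m \<or> k = 1 \<and> l = 2 \<or>
    (k, l, m) \<in> {(2, 2, 2), (2, 2, 3), (2, 2, 4), (2, 3, 3), (2, 3, 4), (3, 3, 3)}"
proof -
  note eq = sorted_triple_mset_eq[OF assms]
  have one: "{#k, l, m#} = {#1, 1, n#} \<longleftrightarrow> k = 1 \<and> l = 1 \<and> m = n" if "2 \<le> n" for n
    using eq[of 1 1 n] that by simp
  \<comment> \<open>For n = 1 the triple 1, 2, n is not sorted: as a multiset it is 1, 1, 2, which
    also belongs to the first family.\<close>
  have two: "{#k, l, m#} = {#1, 2, n#} \<longleftrightarrow> k = 1 \<and> l = 2 \<and> m = n \<or> n = 1 \<and> k = 1 \<and> l = 1 \<and> m = 2" if "1 \<le> n" for n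
  proof (cases "n = 1")
    case True
    then have "{#1, 2, n#} = {#1, 1, 2#}" by simp
    then have "{#k, l, m#} = {#1, 2, n#} \<longleftrightarrow> k = 1 \<and> l = 1 \<and> m = 2"
      unfolding \<open>{#1, 2, n#} = {#1, 1, 2#}\<close> using eq[of 1 1 2] by simp
    then show ?thesis using True assms by auto
  next
    case False
    then show ?thesis using eq[of 1 2 n] that by simp
  qed
  have "X \<in> listed_parameters \<longleftrightarrow> (\<exists>n\<ge>2. X = {#1, 1, n#}) \<or> (\<exists>n\<ge>1. X = {#1, 2, n#}) \<or> X = {#2, 2, 2#} \<or>
      X = {#2, 2, 3#} \<or> X = {#2, 2, 4#} \<or> X = {#2, 3, 3#} \<or> X = {#2, 3, 4#} \<or> X = {#3, 3, 3#}" for X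
    unfolding listed_parameters_def by blast
  note listed = this[of "{#k, l, m#}"]
  have ex1: "(\<exists>n\<ge>2. {#k, l, m#} = {#1, 1, n#}) \<longleftrightarrow> k = 1 \<and> l = 1 \<and> 2 \<le> m" using one by blast
  have ex2: "(\<exists>n\<ge>1. {#k, l, m#} = {#1, 2, n#}) \<longleftrightarrow> k = 1 \<and> l = 2 \<or> k = 1 \<and> l = 1 \<and> m = 2"
    using two assms by force
  have six: "{#k, l, m#} = {#2, 2, 2#} \<longleftrightarrow> k = 2 \<and> l = 2 \<and> m = 2" "{#k, l, m#} = {#2, 2, 3#} \<longleftrightarrow> k = 2 \<and> l = 2 \<and> m = 3"
    "{#k, l, m#} = {#2, 2, 4#} \<longleftrightarrow> k = 2 \<and> l = 2 \<and> m = 4" "{#k, l, m#} = {#2, 3, 3#} \<longleftrightarrow> k = 2 \<and> l = 3 \<and> m = 3"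
    "{#k, l, m#} = {#2, 3, 4#} \<longleftrightarrow> k = 2 \<and> l = 3 \<and> m = 4" "{#k, l, m#} = {#3, 3, 3#} \<longleftrightarrow> k = 3 \<and> l = 3 \<and> m = 3"
    by (simp_all add: eq)
  show ?thesis unfolding listed ex1 ex2 six by auto
qed

lemma listed_obstruction:
  "0 < k \<and> 0 < l \<and> 0 < m \<and> {#k, l, m#} \<in> listed_parameters \<longrightarrow>
     \<not> separated (path_length k l m) \<or> (k, l, m) \<in> set rogue_triples" (is "?P k l m")
proof (rule sorted_triple_wlog[of ?P])
  have "\<forall>(k, l, m)\<in>set rogue_triples. (l, k, m) \<in> set rogue_triples \<and> (k, m, l) \<in> set rogue_triples"
    by (simp add: rogue_triples_def)
  then have rogue: "(l, k, m) \<in> set rogue_triples \<and> (k, m, l) \<in> set rogue_triples" if "(k, l, m) \<in> set rogue_triples" for k l m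
    using that by blast
  show "?P l k m" if "?P k l m" for k l m
    using that swap_iff(1)[of k l m] rogue[of k l m] by (auto simp: add_mset_commute)
  show "?P k m l" if "?P k l m" for k l m
    using that swap_iff(2)[of k l m] rogue[of k l m] by (auto simp: add_mset_commute)
  show "?P k l m" if klm: "k \<le> l" "l \<le> m" for k l m
  proof
    assume "0 < k \<and> 0 < l \<and> 0 < m \<and> {#k, l, m#} \<in> listed_parameters"
    then consider "k = 1" "l = 1" "2 \<le> m" | "k = 1" "l = 2" "0 < m"
      | "(k, l, m) \<in> {(2, 2, 2), (2, 2, 3), (2, 2, 4), (2, 3, 3), (2, 3, 4), (3, 3, 3)}"
      unfolding listed_sorted_iff[OF klm] by blast
    then show "\<not> separated (path_length k l m) \<or> (k, l, m) \<in> set rogue_triples"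
      by cases (use not_separated_one_one not_separated_one_two in \<open>auto simp: rogue_triples_def\<close>)
  qed
qed

lemma unlisted_good:
  "0 < k \<and> 0 < l \<and> 0 < m \<and> {#k, l, m#} \<notin> listed_parameters \<longrightarrow>
     separated (path_length k l m) \<and> dictatorial (path_length k l m)" (is "?P k l m")
proof (rule sorted_triple_wlog[of ?P])
  show "?P l k m" if "?P k l m" for k l m
    using that swap_iff(1,3)[of k l m] by (auto simp: add_mset_commute)
  show "?P k m l" if "?P k l m" for k l m
    using that swap_iff(2,4)[of k l m] by (auto simp: add_mset_commute)
  show "?P k l m" if klm: "k \<le> l" "l \<le> m" for k l m
  proof
    assume "0 < k \<and> 0 < l \<and> 0 < m \<and> {#k, l, m#} \<notin> listed_parameters"
    then have "k = 1 \<and> l = 1 \<and> m = 1 \<or> k = 1 \<and> 3 \<le> l \<and> 3 \<le> m \<or> k = 2 \<and> l = 2 \<and> 5 \<le> m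
      \<or> k = 2 \<and> 3 \<le> l \<and> (5 \<le> m \<or> l = 4 \<and> m = 4) \<or> 3 \<le> k \<and> 4 \<le> m"
      using klm unfolding listed_sorted_iff[OF klm] by simp presburger
    then consider "k = 1" "l = 1" "m = 1" | "k = 1" "3 \<le> l" "3 \<le> m" | "k = 2" "l = 2" "5 \<le> m"
      | "k = 2" "3 \<le> l" "5 \<le> m \<or> l = 4 \<and> m = 4" | "3 \<le> k" "4 \<le> m"
      by blast
    then show "separated (path_length k l m) \<and> dictatorial (path_length k l m)"
    proof cases
      case 1
      then have "(k, l, m) \<in> set dictatorial_triples" by (simp add: dictatorial_triples_def)
      then show ?thesis using separated_bases(1) dictatorial_bases 1 by blast
    next
      case 2 then show ?thesis using separated_one dictatorial_one by simp
    next
      case 3 then show ?thesis using separated_two_two dictatorial_two by simp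
    next
      case 4 then show ?thesis using separated_two dictatorial_two klm by simp
    next
      case 5 then show ?thesis using separated_three dictatorial_three klm by simp
    qed
  qed
qed

theorem theorem20:
  fixes k l m :: nat
  assumes "k \<ge> 1" and "l \<ge> 1" and "m \<ge> 1"
  shows "({#k, l, m#} \<in> listed_parameters \<longrightarrow> \<not> edge_reflexive (cubic_theta k l m)) \<and>
         ({#k, l, m#} \<notin> listed_parameters \<longrightarrow> edge_reflexive (cubic_theta k l m))"
proof (intro conjI impI)
  assume "{#k, l, m#} \<in> listed_parameters"
  then consider "\<not> separated (path_length k l m)" | "(k, l, m) \<in> set rogue_triples"
    using listed_obstruction[of k l m] assms by auto
  then show "\<not> edge_reflexive (cubic_theta k l m)"
  proof cases
    case 1 then show ?thesis using edge_reflexive_imp(1)[OF assms] by blast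
  next
    case 2 
    then have "check_rogue (theta_words k l m) (star_list k l m)" using rogue_triples_checked by blast
    then show ?thesis by (rule not_edge_reflexive_if_rogue[OF assms])
  qed
next
  assume "{#k, l, m#} \<notin> listed_parameters"
  then have good: "separated (path_length k l m)" "dictatorial (path_length k l m)"
    using unlisted_good[of k l m] assms by auto
  have "positive (path_length k l m)" using assms by (simp add: positive_path_length)
  then obtain c where "edge_colouring (path_length k l m) c" using colouring_if_separated good(1) by blast
  then show "edge_reflexive (cubic_theta k l m)" using edge_reflexive_if[OF assms] good by blast
qed

end
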